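(* Let a finite Markov decision process with state space $\mathcal S$ and set of stationary policies $\Pi_F$ be given, and let $\succsim$ be a preorder on the set $\mathcal U$ of all bounded real sequences. Suppose that $\succsim$ satisfies all of the axioms in at least one of the following two sets: (i) A1, A2, A3, A4, A5, A6, A7; (ii) A1, A5, A8. Then a policy is $\succsim$-optimal within $\Pi_F$ if and only if it is $\succsim_{\mathrm{AO}}$-optimal within $\Pi_F$. In particular, a $\succsim$-optimal policy exists within $\Pi_F$.
   Context: **Finite MDP.** $\mathcal S$ (states) and $\mathcal A$ (actions) are finite sets; for each $a\in\mathcal A$ there is a transition probability function $p_a(s'\mid s)$ on $\mathcal S$; and $r:\mathcal S\times\mathcal A\to\mathbb R$ is a reward function. $F$ is the set of all functions $f:\mathcal S\to\mathcal A$. For $f\in F$, $\mathbf Q(f)$ is the transition matrix with entries $\mathbf Q(f)_{s,s'}=p_{f(s)}(s'\mid s)$ and $\mathbf r(f)$ is the reward vector with entries $\mathbf r(f)_s=r(s,f(s))$. A policy is a sequence $\pi=(f_1,f_2,f_3,\dots)$ in $F$; it is stationary if it has the form $(f,f,f,\dots)$ for some $f\in F$. $\Pi_F$ is the set of stationary policies. For an initial state $s\in\mathcal S$ and a policy $\pi=(f_1,f_2,\dots)$, the generated stream $u(s,\pi)=(u_1,u_2,\dots)$ of expected rewards is $u_1=[\mathbf r(f_1)]_s$ and $u_t=[\mathbf Q(f_1)\cdots\mathbf Q(f_{t-1})\,\mathbf r(f_t)]_s$ for $t\ge 2$. $\mathcal U_F=\{u(s,\pi): s\in\mathcal S,\ \pi\in\Pi_F\}$.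 **Preferences and optimality.** $\mathcal U$ is the set of all bounded real sequences $u=(u_1,u_2,\dots)$. A preorder is a reflexive and transitive (not necessarily complete) binary relation $\succsim$. Write $u\succ v$ if $u\succsim v$ and not $v\succsim u$; write $u\sim v$ if $u\succsim v$ and $v\succsim u$. The preorder $\succsim$ compares $u$ and $v$ if $u\succsim v$ or $v\succsim u$. A policy $\pi^*\in\Pi_F$ is $\succsim$-optimal within $\Pi_F$ if $u(s,\pi^* )\succsim u(s,\pi)$ for every $\pi\in\Pi_F$ and every $s\in\mathcal S$. For $c\in\mathbb R$, $(c,u)=(c,u_1,u_2,\dots)$. For $n\ge1$, $u_{[n]}$ is obtained from $u$ by replacing $u_t$ with $0$ for all $t>n$. The average of $u\in\mathcal U$ is $\bar u=\lim_{n\to\infty}\frac1n\sum_{t=1}^n u_t$; it is well defined if this limit exists. **Axioms.** - A1: for all $u,v\in\mathcal U$, if $u_t\ge v_t$ for all $t$ and $u_t>v_t$ for some $t$, then $u\succ v$. - A2: for all $u,v\in\mathcal U$, if $u$ can be obtained from $v$ by interchanging two entries of $v$, then $u\sim v$. - A3: for all $u,v\in\mathcal U$, if there exists $N>1$ such that $u_{[n]}\succ v_{[n]}$ for all $n\ge N$, then $u\succsim v$. - A4: for all $u,v\in\mathcal U$ and $c\in\mathbb R$, $(c,u)\succsim(c,v)$ if and only if $u\succsim v$. - A5: for all $u,v,\alpha\in\mathcal U$, if $u\succsim v$, then $u+\alpha\succsim v+\alpha$. - A6: for all $u,v\in\mathcal U_F$, $\succsim$ compares $u$ and $v$. - A7: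 for every $u\in\mathcal U$, $\{v\in\mathcal U: u\succsim v\}$ is a closed subset of $\mathcal U$, where $\mathcal U$ carries the metric $d(u,v)=\min\{1,\sum_{i=1}^\infty|u_i-v_i|\}$. - A8 (compensation principle): for every $u\in\mathcal U$, if $\bar u$ is well defined, then $(\bar u,u)\sim u$. **Average overtaking preorder.** With $\sigma_T(w)=\sum_{t=1}^T w_t$, $u\succsim_{\mathrm{AO}}v$ if and only if $\liminf_{T\to\infty}\frac1T\sum_{t=1}^T\sigma_t(u-v)\ge 0$. *)

theory Defs
  imports "HOL-Analysis.Analysis"
begin

section \<open>Bounded real sequences\<close>

text \<open>
  Sequences \<open>(u\<^sub>1, u\<^sub>2, \<dots>)\<close> are functions on \<^typ>\<open>nat\<close>, shifted by one: \<open>u\<^sub>t\<close> is \<open>u (t - 1)\<close>.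
  The same convention is used for policies \<open>(f\<^sub>1, f\<^sub>2, \<dots>)\<close>.
\<close>

definition bseqs :: "(nat \<Rightarrow> real) set" where
  "bseqs = {u. bounded (range u)}"

definition prepend :: "real \<Rightarrow> (nat \<Rightarrow> real) \<Rightarrow> nat \<Rightarrow> real" where
  "prepend c u = case_nat c u"

definition truncate :: "nat \<Rightarrow> (nat \<Rightarrow> real) \<Rightarrow> nat \<Rightarrow> real" where
  "truncate n u = (\<lambda>t. if t < n then u t else 0)"

definition partial_avg :: "(nat \<Rightarrow> real) \<Rightarrow> nat \<Rightarrow> real" where
  "partial_avg u n = (\<Sum>t<n. u t) / real n"

definition has_average :: "(nat \<Rightarrow> real) \<Rightarrow> bool" where
  "has_average u \<longleftrightarrow> convergent (partial_avg u)"

definition average :: "(nat \<Rightarrow> real) \<Rightarrow> real" where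
  "average u = lim (partial_avg u)"

text \<open>The series is taken in \<^typ>\<open>ennreal\<close>, so that the distance is \<open>1\<close> when it diverges.\<close>

definition l1_dist :: "(nat \<Rightarrow> real) \<Rightarrow> (nat \<Rightarrow> real) \<Rightarrow> real" where
  "l1_dist u v = enn2real (min 1 (\<Sum>i. ennreal \<bar>u i - v i\<bar>))"

lemma ennreal_l1_dist: "ennreal (l1_dist u v) = min 1 (\<Sum>i. ennreal \<bar>u i - v i\<bar>)"
  unfolding l1_dist_def
  by (rule ennreal_enn2real) (rule le_less_trans[OF min.cobounded1 ennreal_one_less_top])

lemma min_one_le_add:
  fixes a b c :: ennreal
  assumes "a \<le> b + c"
  shows "min 1 a \<le> min 1 b + min 1 c"
proof -
  consider "min 1 b = 1" | "min 1 c = 1" | "min 1 b = b" "min 1 c = c"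
    unfolding min_def by metis
  then show ?thesis
  proof cases
    case 1
    show ?thesis
      unfolding 1 by (rule order_trans[OF min.cobounded1]) (rule le_iff_add[THEN iffD2], blast)
  next
    case 2
    show ?thesis
      unfolding 2 add.commute[of _ 1]
      by (rule order_trans[OF min.cobounded1]) (rule le_iff_add[THEN iffD2], blast)
  next
    case 3
    show ?thesis
      unfolding 3 by (rule order_trans[OF min.cobounded2 assms])
  qed
qed

lemma Metric_space_bseqs: "Metric_space bseqs l1_dist"
proof
  fix u v w :: "nat \<Rightarrow> real"
  have nonneg: "0 \<le> l1_dist x y" for x y
    unfolding l1_dist_def by (rule enn2real_nonneg)
  show "0 \<le> l1_dist u v"
    by (rule nonneg)
  show "l1_dist u v = l1_dist v u"
    by (simp only: l1_dist_def abs_minus_commute)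
  show "l1_dist u v = 0 \<longleftrightarrow> u = v"
  proof
    assume "l1_dist u v = 0"
    then have "min 1 (\<Sum>i. ennreal \<bar>u i - v i\<bar>) = 0"
      by (simp only: ennreal_l1_dist[symmetric] ennreal_0)
    then have sum0: "(\<Sum>i. ennreal \<bar>u i - v i\<bar>) = 0"
      unfolding min_def by (metis zero_neq_one)
    show "u = v"
    proof
      fix i
      have "ennreal \<bar>u i - v i\<bar> = 0"
        using sum0 suminf_eq_zero_iff[OF summableI zero_le, of "\<lambda>i. ennreal \<bar>u i - v i\<bar>"]
        by (rule_tac x = i in spec) (erule iffD1[rotated])
      then show "u i = v i"
        by simp
    qed
  next
    assume "u = v"
    then show "l1_dist u v = 0"
      by (simp add: l1_dist_def)
  qed
  have "(\<Sum>i. ennreal \<bar>u i - w i\<bar>) \<le> (\<Sum>i. ennreal \<bar>u i - v i\<bar> + ennreal \<bar>v i - w i\<bar>)"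
  proof (rule suminf_le)
    fix i
    have "ennreal \<bar>u i - w i\<bar> \<le> ennreal (\<bar>u i - v i\<bar> + \<bar>v i - w i\<bar>)"
      by (rule ennreal_leI) linarith
    then show "ennreal \<bar>u i - w i\<bar> \<le> ennreal \<bar>u i - v i\<bar> + ennreal \<bar>v i - w i\<bar>"
      by (simp only: ennreal_plus[OF abs_ge_zero abs_ge_zero])
  qed (rule summableI)+
  also have "\<dots> = (\<Sum>i. ennreal \<bar>u i - v i\<bar>) + (\<Sum>i. ennreal \<bar>v i - w i\<bar>)"
    by (rule suminf_add[symmetric]) (rule summableI)+
  finally have "ennreal (l1_dist u w) \<le> ennreal (l1_dist u v) + ennreal (l1_dist v w)"
    unfolding ennreal_l1_dist by (rule min_one_le_add)
  also have "\<dots> = ennreal (l1_dist u v + l1_dist v w)"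
    by (rule ennreal_plus[symmetric]) (rule nonneg)+
  finally show "l1_dist u w \<le> l1_dist u v + l1_dist v w"
    by (subst (asm) ennreal_le_iff) (intro add_nonneg_nonneg nonneg)
qed


section \<open>Finite Markov decision processes\<close>

text \<open>
  States and actions are the elements of finite types.  \<open>p a s s'\<close> is the probability
  \<open>p\<^sub>a(s' | s)\<close> of moving from \<open>s\<close> to \<open>s'\<close> under action \<open>a\<close>.
\<close>

definition transition_probs :: "('a::finite \<Rightarrow> 's::finite \<Rightarrow> 's \<Rightarrow> real) \<Rightarrow> bool" where
  "transition_probs p \<longleftrightarrow> (\<forall>a s. (\<forall>s'. 0 \<le> p a s s') \<and> (\<Sum>s'\<in>UNIV. p a s s') = 1)"

definition trans_mat :: "('a::finite \<Rightarrow> 's::finite \<Rightarrow> 's \<Rightarrow> real) \<Rightarrow> ('s \<Rightarrow> 'a) \<Rightarrow> real^'s^'s" where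
  "trans_mat p f = (\<chi> s s'. p (f s) s s')"

definition reward_vec :: "('s::finite \<Rightarrow> 'a::finite \<Rightarrow> real) \<Rightarrow> ('s \<Rightarrow> 'a) \<Rightarrow> real^'s" where
  "reward_vec r f = (\<chi> s. r s (f s))"

type_synonym ('s, 'a) policy = "nat \<Rightarrow> 's \<Rightarrow> 'a"

definition stationary_policies :: "('s, 'a) policy set" where
  "stationary_policies = {\<pi>. \<exists>f. \<pi> = (\<lambda>t. f)}"

primrec trans_prod ::
  "('a::finite \<Rightarrow> 's::finite \<Rightarrow> 's \<Rightarrow> real) \<Rightarrow> ('s, 'a) policy \<Rightarrow> nat \<Rightarrow> real^'s^'s" where
  "trans_prod p \<pi> 0 = mat 1"
| "trans_prod p \<pi> (Suc t) = trans_prod p \<pi> t ** trans_mat p (\<pi> t)"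

definition reward_stream ::
  "('a::finite \<Rightarrow> 's::finite \<Rightarrow> 's \<Rightarrow> real) \<Rightarrow> ('s \<Rightarrow> 'a \<Rightarrow> real) \<Rightarrow> 's \<Rightarrow> ('s, 'a) policy
    \<Rightarrow> nat \<Rightarrow> real" where
  "reward_stream p r s \<pi> t = (trans_prod p \<pi> t *v reward_vec r (\<pi> t)) $ s"

definition stationary_streams ::
  "('a::finite \<Rightarrow> 's::finite \<Rightarrow> 's \<Rightarrow> real) \<Rightarrow> ('s \<Rightarrow> 'a \<Rightarrow> real) \<Rightarrow> (nat \<Rightarrow> real) set" where
  "stationary_streams p r = {reward_stream p r s \<pi> | s \<pi>. \<pi> \<in> stationary_policies}"

definition optimal_policy ::
  "('a::finite \<Rightarrow> 's::finite \<Rightarrow> 's \<Rightarrow> real) \<Rightarrow> ('s \<Rightarrow> 'a \<Rightarrow> real) \<Rightarrow> (nat \<Rightarrow> real) rel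
    \<Rightarrow> ('s, 'a) policy \<Rightarrow> bool" where
  "optimal_policy p r R \<pi> \<longleftrightarrow> \<pi> \<in> stationary_policies \<and>
     (\<forall>\<pi>'\<in>stationary_policies. \<forall>s. (reward_stream p r s \<pi>, reward_stream p r s \<pi>') \<in> R)"


section \<open>Preferences over streams\<close>

text \<open>\<open>(u, v) \<in> R\<close> stands for \<open>u\<close> being weakly preferred to \<open>v\<close>.\<close>

definition strictly_pref :: "(nat \<Rightarrow> real) rel \<Rightarrow> (nat \<Rightarrow> real) \<Rightarrow> (nat \<Rightarrow> real) \<Rightarrow> bool" where
  "strictly_pref R u v \<longleftrightarrow> (u, v) \<in> R \<and> (v, u) \<notin> R"

definition indifferent :: "(nat \<Rightarrow> real) rel \<Rightarrow> (nat \<Rightarrow> real) \<Rightarrow> (nat \<Rightarrow> real) \<Rightarrow> bool" where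
  "indifferent R u v \<longleftrightarrow> (u, v) \<in> R \<and> (v, u) \<in> R"

definition compares :: "(nat \<Rightarrow> real) rel \<Rightarrow> (nat \<Rightarrow> real) \<Rightarrow> (nat \<Rightarrow> real) \<Rightarrow> bool" where
  "compares R u v \<longleftrightarrow> (u, v) \<in> R \<or> (v, u) \<in> R"

definition axiom_A1 :: "(nat \<Rightarrow> real) rel \<Rightarrow> bool" where
  "axiom_A1 R \<longleftrightarrow> (\<forall>u\<in>bseqs. \<forall>v\<in>bseqs.
     (\<forall>t. u t \<ge> v t) \<and> (\<exists>t. u t > v t) \<longrightarrow> strictly_pref R u v)"

definition axiom_A2 :: "(nat \<Rightarrow> real) rel \<Rightarrow> bool" where
  "axiom_A2 R \<longleftrightarrow> (\<forall>u\<in>bseqs. \<forall>v\<in>bseqs.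
     (\<exists>i j. i \<noteq> j \<and> u = v(i := v j, j := v i)) \<longrightarrow> indifferent R u v)"

definition axiom_A3 :: "(nat \<Rightarrow> real) rel \<Rightarrow> bool" where
  "axiom_A3 R \<longleftrightarrow> (\<forall>u\<in>bseqs. \<forall>v\<in>bseqs.
     (\<exists>N>1. \<forall>n\<ge>N. strictly_pref R (truncate n u) (truncate n v)) \<longrightarrow> (u, v) \<in> R)"

definition axiom_A4 :: "(nat \<Rightarrow> real) rel \<Rightarrow> bool" where
  "axiom_A4 R \<longleftrightarrow> (\<forall>u\<in>bseqs. \<forall>v\<in>bseqs. \<forall>c. (prepend c u, prepend c v) \<in> R \<longleftrightarrow> (u, v) \<in> R)"

definition axiom_A5 :: "(nat \<Rightarrow> real) rel \<Rightarrow> bool" where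
  "axiom_A5 R \<longleftrightarrow> (\<forall>u\<in>bseqs. \<forall>v\<in>bseqs. \<forall>\<alpha>\<in>bseqs.
     (u, v) \<in> R \<longrightarrow> (\<lambda>t. u t + \<alpha> t, \<lambda>t. v t + \<alpha> t) \<in> R)"

definition axiom_A6 ::
  "('a::finite \<Rightarrow> 's::finite \<Rightarrow> 's \<Rightarrow> real) \<Rightarrow> ('s \<Rightarrow> 'a \<Rightarrow> real) \<Rightarrow> (nat \<Rightarrow> real) rel \<Rightarrow> bool" where
  "axiom_A6 p r R \<longleftrightarrow> (\<forall>u\<in>stationary_streams p r. \<forall>v\<in>stationary_streams p r. compares R u v)"

definition axiom_A7 :: "(nat \<Rightarrow> real) rel \<Rightarrow> bool" where
  "axiom_A7 R \<longleftrightarrow>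
     (\<forall>u\<in>bseqs. closedin (Metric_space.mtopology bseqs l1_dist) {v \<in> bseqs. (u, v) \<in> R})"

definition axiom_A8 :: "(nat \<Rightarrow> real) rel \<Rightarrow> bool" where
  "axiom_A8 R \<longleftrightarrow> (\<forall>u\<in>bseqs. has_average u \<longrightarrow> indifferent R (prepend (average u) u) u)"


section \<open>Average overtaking\<close>

definition sigma :: "nat \<Rightarrow> (nat \<Rightarrow> real) \<Rightarrow> real" where
  "sigma T w = (\<Sum>t<T. w t)"

text \<open>
  The lower limit is taken in \<^typ>\<open>ereal\<close>, since the averages of the partial sums of a
  bounded sequence may be unbounded.
\<close>

definition avg_overtaking :: "(nat \<Rightarrow> real) rel" where
  "avg_overtaking = {(u, v). u \<in> bseqs \<and> v \<in> bseqs \<and>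
     liminf (\<lambda>T. ereal ((\<Sum>t=1..T. sigma t (\<lambda>i. u i - v i)) / real T)) \<ge> 0}"

end

theory Submission
  imports Defs "HOL-Real_Asymp.Real_Asymp"
begin

text \<open>
  For a stationary policy with stochastic matrix \<open>Q\<close>, the space is the direct sum of the kernel and
  the range of \<open>I - Q\<close>; hence the reward vector is \<open>g + (I - Q)\<^sup>2 h\<close> with \<open>Q g = g\<close>, and the difference
  \<open>x\<close> of two stationary streams has the form \<open>x t = d + z t - 2 z (t + 1) + z (t + 2)\<close> with \<open>z\<close>
  bounded.  Average overtaking ranks such differences lexicographically by gain \<open>d\<close> and bias
  \<open>z 0 - z 1\<close>.

  Under A8, \<open>x\<close> is indifferent to a stream that is pointwise nonnegative if the pair is
  lexicographically nonnegative.  Under A1--A7, differences whose partial sums are eventually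
  nonnegative are weakly preferred to \<open>0\<close>.  The partial sums of the sum of \<open>k\<close> successive shifts of
  \<open>x\<close> telescope to \<open>k\<close> times the bias plus a bounded term, so the sign of the bias decides once A6
  makes \<open>x\<close> comparable to \<open>0\<close>; for zero bias, the recurrence of \<open>z\<close> yields a \<open>k\<close> for which the
  bounded term is eventually as small as desired, and A7 applies.

  An optimal policy is one that is discounted optimal for discount factors arbitrarily close to
  \<open>1\<close> (Blackwell).
\<close>

section \<open>Stationary reward streams\<close>

text \<open>The action of Q(f) on vectors as a function, so that its powers are
  \<open>funpow\<close> iterates.\<close>

definition step :: "('a::finite \<Rightarrow> 's::finite \<Rightarrow> 's \<Rightarrow> real) \<Rightarrow> ('s \<Rightarrow> 'a) \<Rightarrow> real^'s \<Rightarrow> real^'s" where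
  "step p f x = trans_mat p f *v x"

lemma step_nth: "step p f x $ s = (\<Sum>s'\<in>UNIV. p (f s) s s' * x $ s')"
  by (simp add: step_def trans_mat_def matrix_vector_mult_def)

lemma linear_step: "linear (step p f)"
  unfolding step_def by (rule matrix_vector_mul_linear)

lemma linear_step_funpow: "linear (step p f ^^ n)"
proof (induction n)
  case 0
  show ?case by (simp add: linear_id[unfolded id_def] id_def)
next
  case (Suc n)
  then show ?case
    using linear_compose[OF Suc linear_step] by (simp add: o_def)
qed

lemma reward_stream_stationary:
  "reward_stream p r s (\<lambda>_. f) t = (step p f ^^ t) (reward_vec r f) $ s"
proof -
  have "trans_prod p (\<lambda>_. f) t *v x = (step p f ^^ t) x" for x
    by (induction t arbitrary: x)
      (simp_all add: matrix_vector_mul_assoc[symmetric] step_def funpow_swap1)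
  then show ?thesis
    by (simp add: reward_stream_def)
qed

lemma reward_stream_0: "reward_stream p r s (\<lambda>_. f) 0 = r s (f s)"
  by (simp add: reward_stream_stationary reward_vec_def)

lemma reward_stream_Suc:
  "reward_stream p r s (\<lambda>_. f) (Suc t) =
    (\<Sum>s'\<in>UNIV. p (f s) s s' * reward_stream p r s' (\<lambda>_. f) t)"
  by (simp add: reward_stream_stationary step_nth)

text \<open>Each entry of Q x is a convex combination of entries of \<open>x\<close>, since the rows
  of Q are probability vectors.\<close>

lemma abs_step_le:
  assumes "transition_probs p" and "\<And>i. \<bar>x $ i\<bar> \<le> C"
  shows "\<bar>step p f x $ s\<bar> \<le> C"
proof -
  have p: "0 \<le> p a s s'" "(\<Sum>s'\<in>UNIV. p a s s') = 1" for a s s'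
    using assms(1) by (auto simp: transition_probs_def)
  have "\<bar>step p f x $ s\<bar> \<le> (\<Sum>s'\<in>UNIV. \<bar>p (f s) s s' * x $ s'\<bar>)"
    unfolding step_nth by (rule sum_abs)
  also have "\<dots> \<le> (\<Sum>s'\<in>UNIV. p (f s) s s' * C)"
    by (intro sum_mono) (simp add: abs_mult p assms(2) mult_left_mono)
  also have "\<dots> = C"
    by (simp add: sum_distrib_right[symmetric] p)
  finally show ?thesis .
qed

lemma abs_step_funpow_le:
  assumes "transition_probs p" and "\<And>i. \<bar>x $ i\<bar> \<le> C"
  shows "\<bar>(step p f ^^ n) x $ s\<bar> \<le> C"
  using assms(2)
proof (induction n arbitrary: s)
  case (Suc n)
  then show ?case
    using abs_step_le[OF assms(1), of "(step p f ^^ n) x" C f s] by simp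
qed simp

lemma abs_step_funpow_le_norm:
  assumes "transition_probs p"
  shows "\<bar>(step p f ^^ n) x $ s\<bar> \<le> norm x"
  using abs_step_funpow_le[OF assms component_le_norm_cart] .

section \<open>Splitting the reward vector along kernel and range of I - Q\<close>

text \<open>The kernel condition makes \<open>f\<close> injective on its range, so by dimension
  \<open>f\<close> maps its range onto itself; hence f x = f (f h) for some
  \<open>h\<close>.\<close>

lemma linear_split_kernel_range:
  fixes f :: "'a::euclidean_space \<Rightarrow> 'a"
  assumes f: "linear f" and ker: "\<And>x. f (f x) = 0 \<Longrightarrow> f x = 0"
  obtains h where "f (x - f h) = 0"
proof -
  have sub: "subspace (range f)"
    by (rule linear_subspace_image[OF f subspace_UNIV])
  have inj: "inj_on f (range f)"
    unfolding linear_inj_on_iff_eq_0[OF f sub] using ker by auto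
  have "f ` range f = range f"
  proof (rule subspace_dim_equal)
    show "subspace (f ` range f)"
      by (rule linear_subspace_image[OF f sub])
    show "dim (range f) \<le> dim (f ` range f)"
      using dim_image_eq[OF f, of "range f"] inj sub by (metis order_refl span_eq_iff)
  qed (use sub in auto)
  then have "f x \<in> f ` range f"
    by auto
  then obtain h where "f x = f (f h)"
    by auto
  then have "f (x - f h) = 0"
    by (simp add: linear_diff[OF f])
  then show thesis
    by (rule that)
qed

lemma step_funpow_telescope:
  "(step p f ^^ n) y = y - (\<Sum>j<n. (step p f ^^ j) (y - step p f y))"
proof (induction n)
  case (Suc n)
  have "(step p f ^^ Suc n) y = (step p f ^^ n) y - (step p f ^^ n) (y - step p f y)"
    by (simp add: linear_diff[OF linear_step_funpow] funpow_swap1)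
  then show ?case
    unfolding sum.lessThan_Suc diff_diff_eq[symmetric] Suc.IH[symmetric] .
qed simp

text \<open>If y = (I - Q) x is fixed by Q, then Q^n x = x - n y, and this orbit is bounded only for
  y = 0.\<close>

lemma step_kernel_range:
  assumes "transition_probs p"
    and "(x - step p f x) - step p f (x - step p f x) = 0"
  shows "x - step p f x = 0"
proof -
  define y where "y = x - step p f x"
  have fix1: "step p f y = y"
    using assms(2) by (simp add: y_def)
  have fixn: "(step p f ^^ j) y = y" for j
    by (induction j) (simp_all add: fix1)
  have "y $ s = 0" for s
  proof (rule ccontr)
    assume "y $ s \<noteq> 0"
    \<comment> \<open>The bound \<open>2 * norm x\<close> dominates every entry of x - Q^n x, which
      for this \<open>n\<close> would equal n y.\<close>
    then obtain n :: nat where n: "2 * norm x < real n * \<bar>y $ s\<bar>"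
      using ex_less_of_nat_mult[of "\<bar>y $ s\<bar>" "2 * norm x"] by auto
    have "(step p f ^^ n) x = x - real n *\<^sub>R y"
      using step_funpow_telescope[of n p f x] by (simp add: y_def[symmetric] fixn scaleR_conv_of_real sum_constant_scaleR)
    then have "real n * y $ s = x $ s - (step p f ^^ n) x $ s"
      by simp
    moreover have "\<bar>x $ s\<bar> \<le> norm x" "\<bar>(step p f ^^ n) x $ s\<bar> \<le> norm x"
      using component_le_norm_cart abs_step_funpow_le_norm[OF assms(1)] by blast+
    ultimately have "\<bar>real n * y $ s\<bar> \<le> 2 * norm x"
      by linarith
    then show False
      using n by (simp add: abs_mult)
  qed
  then show ?thesis
    by (simp add: y_def[symmetric] vec_eq_iff)
qed

text \<open>The splitting is used twice: \<open>x\<close> leaves a fixed vector plus (I - Q) h0, and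
  splitting \<open>h0\<close> in turn replaces it by (I - Q) h, because I - Q annihilates the part
  of \<open>h0\<close> in its kernel.\<close>

lemma stochastic_decomposition:
  assumes "transition_probs p"
  obtains g h where "step p f g = g"
    and "x = g + (h - step p f h) - step p f (h - step p f h)"
proof -
  let ?D = "\<lambda>x. x - step p f x"
  have lin: "linear ?D"
    by (rule linear_compose_sub[OF linear_ident linear_step])
  note split = linear_split_kernel_range[OF lin step_kernel_range[OF assms]]
  obtain h0 where h0: "?D (x - ?D h0) = 0"
    by (rule split)
  obtain h where h: "?D (h0 - ?D h) = 0"
    by (rule split)
  have "?D h0 = ?D (?D h)"
    using h linear_diff[OF lin] by (metis right_minus_eq)
  then show thesis
    using h0 by (intro that[of "x - ?D h0" h]) (simp_all add: algebra_simps)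
qed

text \<open>Applying Q^t to g + (I - Q)^2 h fixes \<open>g\<close> and turns the square into a
  second difference of the orbit of \<open>h\<close>.\<close>

lemma stationary_stream_form:
  assumes "transition_probs p"
  obtains c :: real and h :: "real^'s::finite"
  where "\<And>t. reward_stream p r s (\<lambda>_. f) t =
    c + (step p f ^^ t) h $ s - 2 * (step p f ^^ Suc t) h $ s + (step p f ^^ Suc (Suc t)) h $ s"
proof -
  obtain g h where g: "step p f g = g"
    and x: "reward_vec r f = g + (h - step p f h) - step p f (h - step p f h)"
    by (rule stochastic_decomposition[OF assms])
  have fixn: "(step p f ^^ j) g = g" for j
    by (induction j) (simp_all add: g)
  show thesis
  proof (rule that[of "g $ s" h])
    fix t
    have "(step p f ^^ t) (reward_vec r f) = g + (step p f ^^ t) h - (step p f ^^ Suc t) h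
      - ((step p f ^^ Suc t) h - (step p f ^^ Suc (Suc t)) h)"
      by (simp only: x linear_diff[OF linear_step_funpow] linear_add[OF linear_step_funpow]
          linear_diff[OF linear_step] fixn funpow_Suc_right comp_def add_diff_eq)
    then show "reward_stream p r s (\<lambda>_. f) t = g $ s + (step p f ^^ t) h $ s
      - 2 * (step p f ^^ Suc t) h $ s + (step p f ^^ Suc (Suc t)) h $ s"
      by (simp add: reward_stream_stationary)
  qed
qed

lemma bseqs_iff: "u \<in> bseqs \<longleftrightarrow> (\<exists>C. \<forall>t. \<bar>u t\<bar> \<le> C)"
  by (auto simp: bseqs_def bounded_iff)

lemma stationary_streams_bseqs:
  assumes "transition_probs p"
  shows "reward_stream p r s (\<lambda>_. f) \<in> bseqs"
  unfolding bseqs_iff reward_stream_stationary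
  using abs_step_funpow_le_norm[OF assms] by blast

section \<open>Recurrence of differences of stationary orbits\<close>

text \<open>A one-sided almost periodicity: one shift \<open>k\<close> must serve all late
  \<open>n\<close> simultaneously.\<close>

definition recurrent :: "(nat \<Rightarrow> real) \<Rightarrow> bool" where
  "recurrent z \<longleftrightarrow> (\<forall>e>0. \<exists>k>0. \<exists>n0. \<forall>n\<ge>n0. \<bar>z (n + k) - z n\<bar> < e)"

text \<open>The orbit of a pair of vectors is bounded, hence two of its points are close; since steps do
  not increase the maximum norm, the two points stay close forever.\<close>

lemma recurrent_step_diff:
  assumes "transition_probs p"
  shows "recurrent (\<lambda>t. (step p f ^^ t) h $ s - (step p f' ^^ t) h' $ s)"
  unfolding recurrent_def
proof (intro allI impI)
  fix e :: real
  assume e: "0 < e"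
  \<comment> \<open>Both orbits are put into one product space so that a single convergent
    subsequence, and hence a single shift \<open>k\<close>, serves both.\<close>
  define X where "X t = ((step p f ^^ t) h, (step p f' ^^ t) h')" for t
  have "bounded (range X)"
  proof -
    have "bounded (range (\<lambda>t. (step p f ^^ t) h))" for f h
      unfolding bounded_iff
      using order_trans[OF norm_le_l1_cart sum_bounded_above[OF abs_step_funpow_le_norm[OF assms]]]
      by blast
    then have "bounded (range (\<lambda>t. (step p f ^^ t) h) \<times> range (\<lambda>t. (step p f' ^^ t) h'))"
      by (intro bounded_Times)
    then show ?thesis
      by (rule bounded_subset) (auto simp: X_def)
  qed
  then obtain l \<rho> where \<rho>: "strict_mono (\<rho> :: nat \<Rightarrow> nat)" "(X \<circ> \<rho>) \<longlonglongrightarrow> l"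
    using bounded_imp_convergent_subsequence by blast
  then have "Cauchy (X \<circ> \<rho>)"
    by (auto intro: LIMSEQ_imp_Cauchy)
  then obtain N where N: "\<And>m n. m \<ge> N \<Longrightarrow> n \<ge> N \<Longrightarrow> dist (X (\<rho> m)) (X (\<rho> n)) < e / 4"
    unfolding Cauchy_def using e by (metis comp_apply divide_pos_pos zero_less_numeral)
  define n0 where "n0 = \<rho> N"
  define k where "k = \<rho> (Suc N) - \<rho> N"
  have lt: "\<rho> N < \<rho> (Suc N)"
    using \<rho>(1) by (simp add: strict_mono_less)
  then have k: "k > 0" "\<rho> (Suc N) = n0 + k"
    by (simp_all add: k_def n0_def)
  have d: "dist (X (n0 + k)) (X n0) < e / 4"
    using N[of "Suc N" N] by (simp add: k n0_def[symmetric])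
  have close: "\<bar>(step p f ^^ (n + k)) h $ s - (step p f ^^ n) h $ s\<bar> \<le> e / 4"
    if n: "n \<ge> n0" and c: "norm ((step p f ^^ (n0 + k)) h - (step p f ^^ n0) h) \<le> e / 4" for f h n
  proof -
    obtain m where m: "n = m + n0"
      using n by (metis add.commute le_Suc_ex)
    have "(step p f ^^ (n + k)) h - (step p f ^^ n) h =
        (step p f ^^ m) ((step p f ^^ (n0 + k)) h - (step p f ^^ n0) h)"
      by (simp add: m linear_diff[OF linear_step_funpow] funpow_add add.assoc)
    then have "(step p f ^^ (n + k)) h $ s - (step p f ^^ n) h $ s =
        (step p f ^^ m) ((step p f ^^ (n0 + k)) h - (step p f ^^ n0) h) $ s"
      by (metis vector_minus_component)
    then show ?thesis
      using abs_step_funpow_le_norm[OF assms, where f = f and n = m and s = s] c by (smt (verit))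
  qed
  have "norm ((step p f ^^ (n0 + k)) h - (step p f ^^ n0) h) \<le> e / 4"
    using d dist_fst_le[of "X (n0 + k)" "X n0"] by (simp add: X_def dist_norm)
  moreover have "norm ((step p f' ^^ (n0 + k)) h' - (step p f' ^^ n0) h') \<le> e / 4"
    using d dist_snd_le[of "X (n0 + k)" "X n0"] by (simp add: X_def dist_norm)
  ultimately have "\<bar>((step p f ^^ (n + k)) h $ s - (step p f' ^^ (n + k)) h' $ s) -
      ((step p f ^^ n) h $ s - (step p f' ^^ n) h' $ s)\<bar> < e" if "n \<ge> n0" for n
    using close[OF that, of f h] close[OF that, of f' h'] e by linarith
  then show "\<exists>k>0. \<exists>n0. \<forall>n\<ge>n0. \<bar>((step p f ^^ (n + k)) h $ s - (step p f' ^^ (n + k)) h' $ s) -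
      ((step p f ^^ n) h $ s - (step p f' ^^ n) h' $ s)\<bar> < e"
    using k(1) by blast
qed

text \<open>Here \<open>d\<close> is the difference of gains and \<open>z\<close> that of the two
  orbits. Recurrence is established for \<open>z\<close> directly because the orbits must share
  their shifts.\<close>

lemma stationary_diff_form:
  assumes "transition_probs p"
  obtains d z where "z \<in> bseqs" "recurrent z"
    and "\<And>t. reward_stream p r s (\<lambda>_. f) t - reward_stream p r s (\<lambda>_. f') t =
      d + z t - 2 * z (Suc t) + z (Suc (Suc t))"
proof -
  obtain c h where ch: "\<And>t. reward_stream p r s (\<lambda>_. f) t = c + (step p f ^^ t) h $ s
      - 2 * (step p f ^^ Suc t) h $ s + (step p f ^^ Suc (Suc t)) h $ s"
    using stationary_stream_form[OF assms, of r s f] by blast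
  obtain c' h' where ch': "\<And>t. reward_stream p r s (\<lambda>_. f') t = c' + (step p f' ^^ t) h' $ s
      - 2 * (step p f' ^^ Suc t) h' $ s + (step p f' ^^ Suc (Suc t)) h' $ s"
    using stationary_stream_form[OF assms, of r s f'] by blast
  define z where "z t = (step p f ^^ t) h $ s - (step p f' ^^ t) h' $ s" for t
  have "\<bar>z t\<bar> \<le> norm h + norm h'" for t
    using abs_step_funpow_le_norm[OF assms, where f = f and n = t and x = h and s = s]
      abs_step_funpow_le_norm[OF assms, where f = f' and n = t and x = h' and s = s] by (simp add: z_def)
  then have "z \<in> bseqs"
    unfolding bseqs_iff by blast
  moreover have "recurrent z"
    unfolding z_def by (rule recurrent_step_diff[OF assms])
  moreover have "reward_stream p r s (\<lambda>_. f) t - reward_stream p r s (\<lambda>_. f') t =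
      (c - c') + z t - 2 * z (Suc t) + z (Suc (Suc t))" for t
    unfolding ch ch' z_def by (simp del: funpow.simps)
  ultimately show thesis
    by (rule that)
qed

section \<open>Discounting\<close>

lemma bseqs_abs_summable:
  fixes \<beta> :: real
  assumes "u \<in> bseqs" "0 < \<beta>" "\<beta> < 1"
  shows "summable (\<lambda>t. \<bar>\<beta> ^ t * u t\<bar>)"
proof -
  obtain C where C: "\<And>t. \<bar>u t\<bar> \<le> C"
    using assms(1) bseqs_iff by blast
  have "summable (\<lambda>t. C * \<beta> ^ t)"
    using assms by (intro summable_mult summable_geometric) auto
  moreover have "norm \<bar>\<beta> ^ t * u t\<bar> \<le> C * \<beta> ^ t" for t
    using mult_right_mono[OF C, of "\<beta> ^ t" t] assms by (simp add: abs_mult mult.commute)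
  ultimately show ?thesis
    by (rule summable_comparison_test'[where N = 0])
qed

lemma bseqs_summable:
  fixes \<beta> :: real
  assumes "u \<in> bseqs" "0 < \<beta>" "\<beta> < 1"
  shows "summable (\<lambda>t. \<beta> ^ t * u t)"
  using bseqs_abs_summable[OF assms] by (rule summable_rabs_cancel)

lemma abs_discounted_sum_le:
  fixes \<beta> :: real
  assumes C: "\<And>t. \<bar>u t\<bar> \<le> C" and \<beta>: "0 < \<beta>" "\<beta> < 1"
  shows "\<bar>\<Sum>t. \<beta> ^ t * u t\<bar> \<le> C / (1 - \<beta>)"
proof -
  have u: "u \<in> bseqs"
    using C bseqs_iff by blast
  have "\<bar>\<Sum>t. \<beta> ^ t * u t\<bar> \<le> (\<Sum>t. \<bar>\<beta> ^ t * u t\<bar>)"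
    by (rule summable_rabs[OF bseqs_abs_summable[OF u \<beta>]])
  also have "\<dots> \<le> (\<Sum>t. \<beta> ^ t * C)"
    using \<beta> C bseqs_abs_summable[OF u \<beta>]
    by (intro suminf_le) (auto simp: abs_mult intro!: mult_left_mono summable_mult2 summable_geometric)
  also have "\<dots> = C / (1 - \<beta>)"
    using \<beta> by (simp add: suminf_mult2[symmetric] suminf_geometric summable_geometric)
  finally show ?thesis .
qed

lemma discounted_sum_shift:
  fixes \<beta> :: real
  assumes "u \<in> bseqs" "0 < \<beta>" "\<beta> < 1"
  shows "(\<Sum>t. \<beta> ^ t * u t) = u 0 + \<beta> * (\<Sum>t. \<beta> ^ t * u (Suc t))"
proof -
  have "(\<lambda>t. u (Suc t)) \<in> bseqs"
    using assms(1) unfolding bseqs_iff by blast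
  then have "summable (\<lambda>t. \<beta> ^ t * u (Suc t))"
    by (rule bseqs_summable) (use assms in auto)
  then show ?thesis
    using suminf_split_head[OF bseqs_summable[OF assms]]
    by (simp add: mult.assoc suminf_mult)
qed

text \<open>As \<open>\<beta> \<longrightarrow> 1\<close>, the remainder is \<open>(1 - \<beta>)\<^sup>2\<close> times a discounted sum of size \<open>O(1 / (1 - \<beta>))\<close>.\<close>

lemma discounted_sum_asymptotics:
  assumes z: "z \<in> bseqs"
    and x: "\<And>t. x t = d + z t - 2 * z (Suc t) + z (Suc (Suc t))"
  shows "((\<lambda>\<beta>. (\<Sum>t. \<beta> ^ t * x t) - d / (1 - \<beta>)) \<longlongrightarrow> z 0 - z 1) (at_left 1)"
proof -
  obtain C where C: "\<And>t. \<bar>z t\<bar> \<le> C"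
    using z bseqs_iff by blast
  define Z where "Z \<beta> = (\<Sum>t. \<beta> ^ t * z t)" for \<beta> :: real
  have ev: "eventually (\<lambda>\<beta>. 0 < \<beta> \<and> \<beta> < 1) (at_left (1::real))"
    by (auto simp: eventually_at_left[of 0 "1::real"] intro!: exI[of _ 0])
  have eq: "(\<Sum>t. \<beta> ^ t * x t) - d / (1 - \<beta>) =
      (1 / \<beta> - 1)\<^sup>2 * Z \<beta> + 2 * z 0 / \<beta> - z 0 / \<beta>\<^sup>2 - z 1 / \<beta>"
    if \<beta>: "0 < \<beta>" "\<beta> < 1" for \<beta>
  proof -
    define Z1 where "Z1 = (\<Sum>t. \<beta> ^ t * z (Suc t))"
    define Z2 where "Z2 = (\<Sum>t. \<beta> ^ t * z (Suc (Suc t)))"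
    have z1: "(\<lambda>t. z (Suc t)) \<in> bseqs" and z2: "(\<lambda>t. z (Suc (Suc t))) \<in> bseqs"
      using z unfolding bseqs_iff by blast+
    have Z: "Z \<beta> = z 0 + \<beta> * Z1" "Z1 = z 1 + \<beta> * Z2"
      using discounted_sum_shift[OF z \<beta>] discounted_sum_shift[OF z1 \<beta>]
      by (simp_all add: Z_def Z1_def Z2_def)
    have "(\<lambda>t. \<beta> ^ t * d + \<beta> ^ t * z t - 2 * (\<beta> ^ t * z (Suc t)) + \<beta> ^ t * z (Suc (Suc t)))
        sums (1 / (1 - \<beta>) * d + Z \<beta> - 2 * Z1 + Z2)"
      unfolding Z_def Z1_def Z2_def
      by (intro sums_add sums_diff sums_mult sums_mult2 summable_sums bseqs_summable z z1 z2 geometric_sums)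
        (use \<beta> in auto)
    then have "(\<lambda>t. \<beta> ^ t * x t) sums (1 / (1 - \<beta>) * d + Z \<beta> - 2 * Z1 + Z2)"
      by (simp add: x algebra_simps)
    then have "(\<Sum>t. \<beta> ^ t * x t) - d / (1 - \<beta>) = Z \<beta> - 2 * Z1 + Z2"
      by (simp add: sums_unique[symmetric])
    \<comment> \<open>The shift identities solved for the shifted sums; after substitution the
      coefficient of \<open>Z \<beta>\<close> is 1 - 2 / \<beta> + 1 / \<beta>^2, a square.\<close>
    moreover have "Z1 = (Z \<beta> - z 0) / \<beta>" "Z2 = ((Z \<beta> - z 0) / \<beta> - z 1) / \<beta>"
      using Z \<beta> by (auto simp: field_simps)
    ultimately show ?thesis
      by (simp add: power2_eq_square diff_divide_distrib add_divide_distrib algebra_simps)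
  qed
  have "((\<lambda>\<beta>. (1 / \<beta> - 1)\<^sup>2 * Z \<beta>) \<longlongrightarrow> 0) (at_left 1)"
  proof (rule Lim_null_comparison)
    show "eventually (\<lambda>\<beta>. norm ((1 / \<beta> - 1)\<^sup>2 * Z \<beta>) \<le> C * (1 - \<beta>) / \<beta>\<^sup>2) (at_left 1)"
      using ev
    proof eventually_elim
      case (elim \<beta>)
      have "norm ((1 / \<beta> - 1)\<^sup>2 * Z \<beta>) \<le> (1 / \<beta> - 1)\<^sup>2 * (C / (1 - \<beta>))"
        using mult_left_mono[OF abs_discounted_sum_le[where u = z, OF C], of \<beta> "(1 / \<beta> - 1)\<^sup>2"] elim
        by (simp add: abs_mult Z_def)
      also have "\<dots> = C * (1 - \<beta>) / \<beta>\<^sup>2"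
        using elim by (simp add: power2_eq_square divide_simps)
      finally show ?case .
    qed
    have "((\<lambda>\<beta>. C * (1 - \<beta>) / \<beta>\<^sup>2) \<longlongrightarrow> C * (1 - 1) / 1\<^sup>2) (at_left 1)"
      by (intro tendsto_intros) auto
    then show "((\<lambda>\<beta>. C * (1 - \<beta>) / \<beta>\<^sup>2) \<longlongrightarrow> 0) (at_left 1)"
      by simp
  qed
  then have "((\<lambda>\<beta>. (1 / \<beta> - 1)\<^sup>2 * Z \<beta> + 2 * z 0 / \<beta> - z 0 / \<beta>\<^sup>2 - z 1 / \<beta>)
      \<longlongrightarrow> 0 + 2 * z 0 / 1 - z 0 / 1\<^sup>2 - z 1 / 1) (at_left 1)"
    by (intro tendsto_intros) auto
  moreover have "eventually (\<lambda>\<beta>. (1 / \<beta> - 1)\<^sup>2 * Z \<beta> + 2 * z 0 / \<beta> - z 0 / \<beta>\<^sup>2 - z 1 / \<beta> =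
      (\<Sum>t. \<beta> ^ t * x t) - d / (1 - \<beta>)) (at_left 1)"
    using ev by eventually_elim (simp add: eq)
  ultimately show ?thesis
    by (simp add: tendsto_cong)
qed

lemma filterlim_tendsto_add_at_bot:
  fixes g :: "'a \<Rightarrow> real"
  assumes "(f \<longlongrightarrow> c) F" "filterlim g at_bot F"
  shows "filterlim (\<lambda>x. f x + g x) at_bot F"
  using filterlim_tendsto_add_at_top[OF tendsto_minus[OF assms(1)], of "\<lambda>x. - g x"] assms(2)
  by (simp add: filterlim_uminus_at_bot)

text \<open>The discounted sum is d / (1 - \<beta>) + (z 0 - z 1) + o(1). A negative
  \<open>d\<close>, or a zero \<open>d\<close> with negative bias, would make it negative for all
  \<beta> close to 1.\<close>

lemma discounted_sum_frequently_nonneg: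
  assumes z: "z \<in> bseqs"
    and x: "\<And>t. x t = d + z t - 2 * z (Suc t) + z (Suc (Suc t))"
    and freq: "frequently (\<lambda>\<beta>. 0 \<le> (\<Sum>t. \<beta> ^ t * x t)) (at_left 1)"
  shows "d > 0 \<or> d = 0 \<and> z 1 \<le> z 0"
proof -
  note lim = discounted_sum_asymptotics[OF z x]
  have "\<not> d < 0"
  proof
    assume d: "d < 0"
    have "filterlim (\<lambda>\<beta>::real. 1 / (1 - \<beta>)) at_top (at_left 1)"
      by real_asymp
    then have "filterlim (\<lambda>\<beta>::real. d * (1 / (1 - \<beta>))) at_bot (at_left 1)"
      using d by (intro filterlim_tendsto_neg_mult_at_bot[OF tendsto_const])
    then have "filterlim (\<lambda>\<beta>. ((\<Sum>t. \<beta> ^ t * x t) - d / (1 - \<beta>)) + d * (1 / (1 - \<beta>))) at_bot (at_left 1)"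
      by (intro filterlim_tendsto_add_at_bot[OF lim])
    then have "eventually (\<lambda>\<beta>. ((\<Sum>t. \<beta> ^ t * x t) - d / (1 - \<beta>)) + d * (1 / (1 - \<beta>)) < 0) (at_left 1)"
      by (simp add: filterlim_at_bot_dense)
    then show False
      using freq by (simp add: frequently_def not_le)
  qed
  moreover have "z 1 \<le> z 0" if "d = 0"
  proof (rule ccontr)
    assume "\<not> z 1 \<le> z 0"
    then have "eventually (\<lambda>\<beta>. (\<Sum>t. \<beta> ^ t * x t) - d / (1 - \<beta>) < 0) (at_left 1)"
      by (intro order_tendstoD(2)[OF lim]) simp
    then show False
      using freq that by (simp add: frequently_def not_le)
  qed
  ultimately show ?thesis
    by linarith
qed

section \<open>Discounted optimality for discount factors near 1\<close>

definition discounted_value ::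
  "('a::finite \<Rightarrow> 's::finite \<Rightarrow> 's \<Rightarrow> real) \<Rightarrow> ('s \<Rightarrow> 'a \<Rightarrow> real) \<Rightarrow> real \<Rightarrow> ('s \<Rightarrow> 'a) \<Rightarrow> 's \<Rightarrow> real" where
  "discounted_value p r \<beta> f s = (\<Sum>t. \<beta> ^ t * reward_stream p r s (\<lambda>_. f) t)"

text \<open>The Bellman equation of a fixed policy: the first reward is split off, and the finite
  sum over successor states is exchanged with the series.\<close>

lemma discounted_value_unfold:
  assumes "transition_probs p" "0 < \<beta>" "\<beta> < 1"
  shows "discounted_value p r \<beta> f s =
    r s (f s) + \<beta> * (\<Sum>s'\<in>UNIV. p (f s) s s' * discounted_value p r \<beta> f s')"
proof -
  have "(\<Sum>t. \<beta> ^ t * (\<Sum>s'\<in>UNIV. p (f s) s s' * reward_stream p r s' (\<lambda>_. f) t)) =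
      (\<Sum>t. \<Sum>s'\<in>UNIV. p (f s) s s' * (\<beta> ^ t * reward_stream p r s' (\<lambda>_. f) t))"
    by (simp add: sum_distrib_left algebra_simps)
  also have "\<dots> = (\<Sum>s'\<in>UNIV. \<Sum>t. p (f s) s s' * (\<beta> ^ t * reward_stream p r s' (\<lambda>_. f) t))"
    by (intro suminf_sum summable_mult bseqs_summable stationary_streams_bseqs assms)
  also have "\<dots> = (\<Sum>s'\<in>UNIV. p (f s) s s' * discounted_value p r \<beta> f s')"
    unfolding discounted_value_def
    by (intro sum.cong refl suminf_mult bseqs_summable stationary_streams_bseqs assms)
  finally show ?thesis
    using discounted_sum_shift[OF stationary_streams_bseqs[OF assms(1)] assms(2,3)]
    by (simp add: discounted_value_def reward_stream_0 reward_stream_Suc)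
qed

text \<open>A minimum principle: at a state where V - M attains its minimum \<open>m\<close>, the
  one-step inequality gives m \<ge> \<beta> m, so m \<ge> 0.\<close>

lemma le_discounted_value:
  assumes p: "transition_probs p" and \<beta>: "0 < \<beta>" "\<beta> < 1"
    and M: "\<And>s. M s \<le> r s (f s) + \<beta> * (\<Sum>s'\<in>UNIV. p (f s) s s' * M s')"
  shows "M s \<le> discounted_value p r \<beta> f s"
proof -
  define D where "D s = discounted_value p r \<beta> f s - M s" for s
  define m where "m = Min (range D)"
  have le: "m \<le> D s" for s
    by (simp add: m_def)
  have "m \<in> range D"
    unfolding m_def by (intro Min_in) auto
  then obtain s0 where s0: "m = D s0"
    by blast
  have pp: "0 \<le> p a s s'" "(\<Sum>s'\<in>UNIV. p a s s') = 1" for a s s'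
    using p by (auto simp: transition_probs_def)
  have "m = (\<Sum>s'\<in>UNIV. p (f s0) s0 s' * m)"
    by (simp add: sum_distrib_right[symmetric] pp)
  also have "\<dots> \<le> (\<Sum>s'\<in>UNIV. p (f s0) s0 s' * D s')"
    by (intro sum_mono mult_left_mono le pp)
  finally have "\<beta> * m \<le> \<beta> * (\<Sum>s'\<in>UNIV. p (f s0) s0 s' * D s')"
    using \<beta> by simp
  also have "\<dots> \<le> D s0"
    using M[of s0] discounted_value_unfold[OF p \<beta>, of r f s0]
    by (simp add: D_def right_diff_distrib sum_subtractf)
  finally have "0 \<le> (1 - \<beta>) * m"
    by (simp add: s0 algebra_simps)
  then have "0 \<le> m"
    using \<beta> by (simp add: zero_le_mult_iff)
  then show ?thesis
    using le[of s] by (simp add: D_def)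
qed

text \<open>A policy maximising the sum of its values over all states is optimal in every state, since
  two policies can be combined into one that is at least as good as both in every state.\<close>

lemma discounted_optimal_exists:
  assumes p: "transition_probs p" and \<beta>: "0 < \<beta>" "\<beta> < 1"
  shows "\<exists>f. \<forall>f' s. discounted_value p r \<beta> f' s \<le> discounted_value p r \<beta> f s"
proof -
  let ?V = "discounted_value p r \<beta>"
  define W where "W f = (\<Sum>s\<in>UNIV. ?V f s)" for f
  have "Max (range W) \<in> range W"
    by (intro Max_in) auto
  then obtain f where f_max: "Max (range W) = W f"
    by (rule imageE)
  have f: "W f' \<le> W f" for f'
    unfolding f_max[symmetric] by (intro Max_ge) auto
  have "?V f' s0 \<le> ?V f s0" for f' s0
  proof (rule ccontr)
    assume less: "\<not> ?V f' s0 \<le> ?V f s0"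
    \<comment> \<open>In each state \<open>g\<close> follows the policy with the larger value there,
      so the pointwise maximum \<open>M\<close> satisfies the one-step inequality for
      \<open>g\<close>.\<close>
    define g where "g s = (if ?V f s < ?V f' s then f' s else f s)" for s
    define M where "M s = max (?V f s) (?V f' s)" for s
    have pp: "0 \<le> p a s s'" for a s s'
      using p by (auto simp: transition_probs_def)
    have "M s \<le> r s (g s) + \<beta> * (\<Sum>s'\<in>UNIV. p (g s) s s' * M s')" for s
    proof -
      have M: "\<beta> * (\<Sum>s'\<in>UNIV. p (g s) s s' * ?V h s') \<le> \<beta> * (\<Sum>s'\<in>UNIV. p (g s) s s' * M s')"
        if "h = f \<or> h = f'" for h
        using that \<beta> pp by (intro mult_left_mono sum_mono) (auto simp: M_def)
      show ?thesis
      proof (cases "?V f s < ?V f' s")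
        case True
        then show ?thesis
          using M[of f'] discounted_value_unfold[OF p \<beta>, of r f' s] by (simp add: M_def g_def)
      next
        case False
        then show ?thesis
          using M[of f] discounted_value_unfold[OF p \<beta>, of r f s] by (simp add: M_def g_def)
      qed
    qed
    then have "M s \<le> ?V g s" for s
      by (rule le_discounted_value[OF p \<beta>])
    then have "?V f s \<le> ?V g s" "?V f s0 < ?V g s0" for s
      using less by (auto simp: M_def) (smt (verit))
    then have "W f < W g"
      unfolding W_def by (intro sum_strict_mono_ex1) auto
    then show False
      using f[of g] by simp
  qed
  then show ?thesis
    by blast
qed

text \<open>Pigeonhole: every \<beta> in (0, 1) has an optimal policy, and there are only finitely
  many functions from states to actions.\<close>

lemma frequently_discounted_optimal:
  assumes p: "transition_probs p"
  obtains f where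
    "frequently (\<lambda>\<beta>. \<forall>f' s. discounted_value p r \<beta> f' s \<le> discounted_value p r \<beta> f s) (at_left 1)"
proof -
  have "eventually (\<lambda>\<beta>. \<exists>f\<in>UNIV. \<forall>f' s. discounted_value p r \<beta> f' s \<le> discounted_value p r \<beta> f s)
      (at_left 1)"
    using discounted_optimal_exists[OF p]
    by (auto simp: eventually_at_left[of 0 "1::real"] intro!: exI[of _ 0])
  then have "\<exists>f\<in>UNIV. frequently
      (\<lambda>\<beta>. \<forall>f' s. discounted_value p r \<beta> f' s \<le> discounted_value p r \<beta> f s) (at_left 1)"
    by (subst frequently_bex_finite_distrib[symmetric]) (auto intro: eventually_frequently)
  then show thesis
    using that by blast
qed

section \<open>Average overtaking\<close>

text \<open>Summing a second difference twice leaves boundary terms only, while the constant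
  \<open>d\<close> accumulates to a triangular number.\<close>

lemma sum_sigma_form:
  assumes x: "\<And>t. x t = d + z t - 2 * z (Suc t) + z (Suc (Suc t))"
  shows "(\<Sum>t=1..T. sigma t x) =
    d * (real T * (real T + 1) / 2) + real T * (z 0 - z 1) - (z 1 - z (Suc T))"
proof -
  have sg: "sigma t x = real t * d + (z 0 - z 1) - (z t - z (Suc t))" for t
    by (induction t) (simp_all add: sigma_def x algebra_simps)
  show ?thesis
    by (induction T) (simp_all add: sg algebra_simps add_divide_distrib)
qed

text \<open>Division by T turns the double sum into d (T + 1) / 2 + (z 0 - z 1) + O(1 / T). It
  diverges with the sign of a nonzero \<open>d\<close> and otherwise converges to the bias.\<close>

lemma avg_overtaking_iff:
  assumes uv: "u \<in> bseqs" "v \<in> bseqs" and z: "z \<in> bseqs"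
    and x: "\<And>t. u t - v t = d + z t - 2 * z (Suc t) + z (Suc (Suc t))"
  shows "(u, v) \<in> avg_overtaking \<longleftrightarrow> d > 0 \<or> d = 0 \<and> z 1 \<le> z 0"
proof -
  define A where "A T = (\<Sum>t=1..T. sigma t (\<lambda>i. u i - v i)) / real T" for T
  have mem: "(u, v) \<in> avg_overtaking \<longleftrightarrow> 0 \<le> liminf (\<lambda>T. ereal (A T))"
    using uv by (simp add: avg_overtaking_def A_def)
  obtain C where C: "\<And>t. \<bar>z t\<bar> \<le> C"
    using z bseqs_iff by blast
  define B where "B T = z 0 - z 1 - (z 1 - z (Suc T)) / real T" for T
  have "(\<lambda>T. (z 1 - z (Suc T)) / real T) \<longlonglongrightarrow> 0"
  proof (rule Lim_null_comparison)
    have "norm ((z 1 - z (Suc T)) / real T) \<le> 2 * C / real T" for T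
      using C[of 1] C[of "Suc T"] by (cases "T = 0") (auto simp: divide_simps)
    then show "eventually (\<lambda>T. norm ((z 1 - z (Suc T)) / real T) \<le> 2 * C / real T) sequentially"
      by simp
    show "(\<lambda>T. 2 * C / real T) \<longlonglongrightarrow> 0"
      by real_asymp
  qed
  then have B: "B \<longlonglongrightarrow> z 0 - z 1"
    unfolding B_def using tendsto_diff[OF tendsto_const[of "z 0 - z 1"]] by fastforce
  have A: "A T = B T + d * ((real T + 1) / 2)" if "T > 0" for T
    using that sum_sigma_form[of "\<lambda>t. u t - v t", OF x, of T] by
    (simp add: A_def B_def divide_simps)
  have ev: "eventually (\<lambda>T. B T + d * ((real T + 1) / 2) = A T) sequentially"
    using eventually_gt_at_top[of 0] by eventually_elim (simp add: A)
  have top: "filterlim (\<lambda>T. (real T + 1) / 2) at_top sequentially"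
    by real_asymp
  consider "d > 0" | "d = 0" | "d < 0"
    by linarith
  then show ?thesis
  proof cases
    case 1
    have "filterlim (\<lambda>T. B T + d * ((real T + 1) / 2)) at_top sequentially"
      by (intro filterlim_tendsto_add_at_top[OF B] filterlim_tendsto_pos_mult_at_top[OF tendsto_const 1 top])
    then have "filterlim A at_top sequentially"
      using filterlim_cong[OF refl refl ev] by blast
    then have "liminf (\<lambda>T. ereal (A T)) = \<infinity>"
      by (intro lim_imp_Liminf) (simp_all add: tendsto_PInfty_eq_at_top)
    then show ?thesis
      using 1 mem by simp
  next
    case 2
    have "A \<longlonglongrightarrow> z 0 - z 1"
      using B ev 2 by (simp add: tendsto_cong)
    then have "liminf (\<lambda>T. ereal (A T)) = ereal (z 0 - z 1)"
      by (intro lim_imp_Liminf) simp_all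
    then show ?thesis
      using 2 mem by simp
  next
    case 3
    have "filterlim (\<lambda>T. B T + d * ((real T + 1) / 2)) at_bot sequentially"
      by (intro filterlim_tendsto_add_at_bot[OF B] filterlim_tendsto_neg_mult_at_bot[OF tendsto_const 3 top])
    then have bot: "filterlim A at_bot sequentially"
      using filterlim_cong[OF refl refl ev] by blast
    have "((\<lambda>T. ereal (A T)) \<longlongrightarrow> -\<infinity>) sequentially"
      unfolding tendsto_MInfty
      using bot by (simp add: filterlim_at_bot_dense)
    then have "liminf (\<lambda>T. ereal (A T)) = -\<infinity>"
      by (intro lim_imp_Liminf) simp_all
    then show ?thesis
      using 3 mem by simp
  qed
qed

section \<open>Translation invariant preorders\<close>

lemma bseqs_const: "(\<lambda>_. c) \<in> bseqs"
  by (auto simp: bseqs_def)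

lemma bseqs_add:
  assumes "u \<in> bseqs" "v \<in> bseqs"
  shows "(\<lambda>t. u t + v t) \<in> bseqs"
proof -
  obtain C D where C: "\<And>t. \<bar>u t\<bar> \<le> C" and D: "\<And>t. \<bar>v t\<bar> \<le> D"
    using assms unfolding bseqs_iff by blast
  have "\<bar>u t + v t\<bar> \<le> C + D" for t
    using C[of t] D[of t] by linarith
  then show ?thesis
    unfolding bseqs_iff by blast
qed

lemma bseqs_uminus: "u \<in> bseqs \<Longrightarrow> (\<lambda>t. - u t) \<in> bseqs"
  by (simp add: bseqs_iff)

lemma bseqs_diff: "u \<in> bseqs \<Longrightarrow> v \<in> bseqs \<Longrightarrow> (\<lambda>t. u t - v t) \<in> bseqs"
  using bseqs_add[OF _ bseqs_uminus, of u v] by simp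

lemma bseqs_prepend:
  assumes "u \<in> bseqs"
  shows "prepend c u \<in> bseqs"
proof -
  obtain C where C: "\<And>t. \<bar>u t\<bar> \<le> C"
    using assms bseqs_iff by blast
  have "\<bar>prepend c u t\<bar> \<le> max \<bar>c\<bar> C" for t
    using C[of "t - 1"] by (cases t) (auto simp: prepend_def)
  then show ?thesis
    unfolding bseqs_iff by blast
qed

lemma bseqs_eventually_0:
  assumes "\<And>t. n \<le> t \<Longrightarrow> u t = 0"
  shows "u \<in> bseqs"
proof -
  have "u t \<in> insert 0 (u ` {..<n})" for t
    by (cases "t < n") (auto simp: assms)
  then have "range u \<subseteq> insert 0 (u ` {..<n})"
    by blast
  then have "finite (range u)"
    by (rule finite_subset) simp
  then show ?thesis
    by (simp add: bseqs_def finite_imp_bounded)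
qed

definition unit_seq :: "nat \<Rightarrow> nat \<Rightarrow> real" where
  "unit_seq k t = of_bool (t = k)"

lemma bseqs_unit_seq: "(\<lambda>t. c * unit_seq k t) \<in> bseqs"
  by (rule bseqs_eventually_0[of "Suc k"]) (auto simp: unit_seq_def)

lemmas bseqs_intros = bseqs_const bseqs_add bseqs_uminus bseqs_diff bseqs_prepend bseqs_unit_seq

lemma has_average_0I:
  assumes "partial_avg u \<longlonglongrightarrow> 0"
  shows "has_average u" "average u = 0"
  using assms unfolding has_average_def average_def by (auto intro: convergentI limI)

lemma partial_avg_bounded_sums:
  assumes "\<And>n. \<bar>\<Sum>t<n. u t\<bar> \<le> C"
  shows "partial_avg u \<longlonglongrightarrow> 0"
proof (rule Lim_null_comparison)
  have "norm (partial_avg u n) \<le> C / real n" for n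
    using assms[of n] by (simp add: partial_avg_def divide_right_mono)
  then show "eventually (\<lambda>n. norm (partial_avg u n) \<le> C / real n) sequentially"
    by simp
  show "(\<lambda>n. C / real n) \<longlonglongrightarrow> 0"
    by real_asymp
qed

locale translation_invariant_preorder =
  fixes R :: "(nat \<Rightarrow> real) rel"
  assumes preorder: "preorder_on bseqs R"
    and A1: "axiom_A1 R"
    and A5: "axiom_A5 R"
begin

text \<open>Translation invariance makes the preorder depend only on differences, so it is encoded
  by its cone of nonnegative streams.\<close>

definition nonneg :: "(nat \<Rightarrow> real) \<Rightarrow> bool" where
  "nonneg x \<longleftrightarrow> (x, \<lambda>_. 0) \<in> R"

text \<open>For bounded \<open>x\<close> this is strict preference over 0: translating by
  \<open>x\<close> turns \<open>nonneg\<close> of - x into weak preference of 0 over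
  \<open>x\<close>.\<close>

definition pos :: "(nat \<Rightarrow> real) \<Rightarrow> bool" where
  "pos x \<longleftrightarrow> nonneg x \<and> \<not> nonneg (\<lambda>t. - x t)"

lemma in_R_translate:
  assumes "(u, v) \<in> R" "\<alpha> \<in> bseqs"
  shows "(\<lambda>t. u t + \<alpha> t, \<lambda>t. v t + \<alpha> t) \<in> R"
  using assms preorder A5 unfolding axiom_A5_def preorder_on_def by blast

lemma in_R_iff:
  assumes "u \<in> bseqs" "v \<in> bseqs"
  shows "(u, v) \<in> R \<longleftrightarrow> nonneg (\<lambda>t. u t - v t)"
proof
  assume "(u, v) \<in> R"
  then show "nonneg (\<lambda>t. u t - v t)"
    using in_R_translate[OF _ bseqs_uminus[OF assms(2)]] by (fastforce simp: nonneg_def)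
next
  assume "nonneg (\<lambda>t. u t - v t)"
  then show "(u, v) \<in> R"
    using in_R_translate[OF _ assms(2)] by (fastforce simp: nonneg_def)
qed

lemma nonneg_bseqs: "nonneg x \<Longrightarrow> x \<in> bseqs"
  using preorder by (auto simp: nonneg_def preorder_on_def)

text \<open>Translating x \<ge> 0 by \<open>y\<close> ranks x + y above \<open>y\<close>, which is
  ranked above 0; transitivity concludes.\<close>

lemma nonneg_add:
  assumes "nonneg x" "nonneg y"
  shows "nonneg (\<lambda>t. x t + y t)"
proof -
  have "(\<lambda>t. x t + y t, y) \<in> R"
    using in_R_translate[OF assms(1)[unfolded nonneg_def] nonneg_bseqs[OF assms(2)]] by simp
  then show ?thesis
    using assms(2) preorder unfolding nonneg_def preorder_on_def by (meson transD)
qed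

lemma pos_of_pointwise:
  assumes "x \<in> bseqs" "\<And>t. 0 \<le> x t" "0 < x k"
  shows "pos x"
proof -
  have "strictly_pref R x (\<lambda>_. 0)"
    using A1[unfolded axiom_A1_def, rule_format, OF assms(1) bseqs_const[of 0]] assms(2,3) by blast
  moreover have "((\<lambda>_. 0), x) \<in> R \<longleftrightarrow> nonneg (\<lambda>t. - x t)"
    using in_R_iff[OF bseqs_const assms(1), of 0] by simp
  ultimately show ?thesis
    by (simp add: pos_def strictly_pref_def nonneg_def)
qed

lemma nonneg_of_pointwise:
  assumes "x \<in> bseqs" "\<And>t. 0 \<le> x t"
  shows "nonneg x"
proof (cases "\<exists>k. 0 < x k")
  case True
  then show ?thesis
    using pos_of_pointwise[OF assms] by (auto simp: pos_def)
next
  case False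
  then have "x = (\<lambda>_. 0)"
    using assms(2) by (metis ext order_less_le)
  then show ?thesis
    using preorder bseqs_const by (auto simp: nonneg_def preorder_on_def refl_on_def)
qed

lemma pos_nonneg_add:
  assumes "pos x" "nonneg y"
  shows "pos (\<lambda>t. x t + y t)"
proof -
  have "nonneg (\<lambda>t. - x t)" if "nonneg (\<lambda>t. - (x t + y t))"
    using nonneg_add[OF that assms(2)] by simp
  then show ?thesis
    using nonneg_add assms by (auto simp: pos_def)
qed

text \<open>On streams of the form arising from stationary policies, both axiom systems force the
  lexicographic order on the pair \<open>(d, z 0 - z 1)\<close> of gain and bias differences.\<close>

lemma nonneg_lexicographic:
  fixes d b :: real
  assumes gain: "0 < d \<Longrightarrow> pos x" "d < 0 \<Longrightarrow> pos (\<lambda>t. - x t)"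
    and bias: "d = 0 \<Longrightarrow> b > 0 \<Longrightarrow> pos x" "d = 0 \<Longrightarrow> b < 0 \<Longrightarrow> pos (\<lambda>t. - x t)"
    and tie: "d = 0 \<Longrightarrow> b = 0 \<Longrightarrow> nonneg x"
  shows "nonneg x \<longleftrightarrow> d > 0 \<or> d = 0 \<and> 0 \<le> b"
  using assms by (cases d "0::real" rule: linorder_cases; cases b "0::real" rule: linorder_cases)
    (auto simp: pos_def)

end

section \<open>The compensation principle\<close>

locale compensation_preorder = translation_invariant_preorder +
  assumes A8: "axiom_A8 R"
begin

text \<open>With average 0 the compensating entry is 0, so A8 allows a delay by one period.\<close>

lemma nonneg_compensation:
  assumes "u \<in> bseqs" "partial_avg u \<longlonglongrightarrow> 0"
  shows "nonneg (\<lambda>t. prepend 0 u t - u t)"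
proof -
  have "indifferent R (prepend (average u) u) u"
    using A8 assms has_average_0I(1)[OF assms(2)] unfolding axiom_A8_def by blast
  then show ?thesis
    using in_R_iff[OF bseqs_prepend[OF assms(1)] assms(1), of 0]
    by (simp add: has_average_0I(2)[OF assms(2)] indifferent_def)
qed

text \<open>With \<open>w\<close> the shifted first difference of \<open>z\<close>, \<open>x\<close>
  is the constant \<open>d\<close>, plus the bias in the first period, plus
  \<open>prepend 0 w\<close> minus \<open>w\<close>. The last part is nonnegative by compensation,
  so the signs of \<open>d\<close> and of the bias decide through A1.\<close>

lemma nonneg_iff_second_difference:
  assumes z: "z \<in> bseqs"
    and x: "\<And>t. x t = d + z t - 2 * z (Suc t) + z (Suc (Suc t))"
  shows "nonneg x \<longleftrightarrow> d > 0 \<or> d = 0 \<and> z 1 \<le> z 0"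
proof -
  have main: "(d > 0 \<longrightarrow> pos x) \<and> (d = 0 \<and> z 1 < z 0 \<longrightarrow> pos x) \<and> (d = 0 \<and> z 1 = z 0 \<longrightarrow> nonneg x)"
    if z: "z \<in> bseqs"
      and x: "\<And>t. x t = d + z t - 2 * z (Suc t) + z (Suc (Suc t))" for x d z
  proof -
    define w where "w t = z (Suc t) - z (Suc (Suc t))" for t
    obtain C where C: "\<And>t. \<bar>z t\<bar> \<le> C"
      using z bseqs_iff by blast
    have z1: "(\<lambda>t. z (Suc t)) \<in> bseqs" and z2: "(\<lambda>t. z (Suc (Suc t))) \<in> bseqs"
      using z unfolding bseqs_iff by blast+
    have w: "w \<in> bseqs"
      unfolding w_def using z1 z2 by (rule bseqs_diff)
    have "\<bar>\<Sum>t<n. w t\<bar> \<le> 2 * C" for n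
    proof -
      have "(\<Sum>t<n. w t) = z 1 - z (Suc n)"
        by (induction n) (simp_all add: w_def)
      then show ?thesis
        using C[of 1] C[of "Suc n"] by (smt (verit))
    qed
    then have w_avg: "partial_avg w \<longlonglongrightarrow> 0"
      by (rule partial_avg_bounded_sums)
    define b where "b = z 0 - z 1"
    have x_eq: "x = (\<lambda>t. (d + b * unit_seq 0 t) + (prepend 0 w t - w t))"
      by (rule ext) (auto simp: x w_def prepend_def unit_seq_def b_def split: nat.split)
    note nn = nonneg_compensation[OF w w_avg]
    have "pos x" if d: "0 < d"
    proof -
      \<comment> \<open>Large enough that an even share of the bias over \<open>n\<close> periods is
        smaller than \<open>d\<close> in absolute value.\<close>
      obtain n :: nat where n: "\<bar>b\<bar> < real n * d"
        using ex_less_of_nat_mult[OF d] by blast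
      then have n0: "n > 0"
        by (cases n) auto
      \<comment> \<open>compensating \<open>v\<close> spreads the entry \<open>b\<close> evenly over the first \<open>n\<close> periods\<close>
      define v where "v t = (if t < n then b * (real (Suc t) / real n - 1) else 0)" for t
      have v: "v \<in> bseqs"
        by (rule bseqs_eventually_0[of n]) (simp add: v_def)
      have "\<bar>\<Sum>t<m. v t\<bar> \<le> (\<Sum>t<n. \<bar>v t\<bar>)" for m
      proof -
        have "\<bar>\<Sum>t<m. v t\<bar> \<le> (\<Sum>t<m. \<bar>v t\<bar>)"
          by (rule sum_abs)
        also have "\<dots> = (\<Sum>t\<in>{..<m} \<inter> {..<n}. \<bar>v t\<bar>)"
          by (rule sum.mono_neutral_right) (auto simp: v_def)
        also have "\<dots> \<le> (\<Sum>t<n. \<bar>v t\<bar>)"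
          by (rule sum_mono2) auto
        finally show ?thesis .
      qed
      then have v_avg: "partial_avg v \<longlonglongrightarrow> 0"
        by (rule partial_avg_bounded_sums)
      define q where "q t = d + (if t < n then b / real n else 0)" for t
      have q: "d + b * unit_seq 0 t = q t + (prepend 0 v t - v t)" for t
        using n0 by (cases t) (auto simp: q_def v_def prepend_def unit_seq_def field_simps not_less le_Suc_eq)
      have "\<bar>b / real n\<bar> < d"
        using n n0 by (simp add: field_simps)
      then have "0 < q t" for t
        using d unfolding q_def by (auto split: if_split simp del: abs_divide)
      moreover have "(\<lambda>t. if t < n then b / real n else 0) \<in> bseqs"
        by (rule bseqs_eventually_0[of n]) simp
      then have "q \<in> bseqs"
        unfolding q_def by (intro bseqs_intros)
      ultimately have "pos q"
        by (intro pos_of_pointwise[where k = 0]) (auto simp: less_imp_le)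
      then show ?thesis
        unfolding x_eq q by (intro pos_nonneg_add nonneg_compensation[OF v v_avg] nn)
    qed
    moreover have "pos x" if "d = 0" "z 1 < z 0"
      unfolding x_eq
    proof (rule pos_nonneg_add[OF _ nn])
      show "pos (\<lambda>t. d + b * unit_seq 0 t)"
        by (rule pos_of_pointwise[OF bseqs_add[OF bseqs_const bseqs_unit_seq], where k = 0])
            (use that in \<open>auto simp: b_def unit_seq_def\<close>)
    qed
    moreover have "nonneg x" if "d = 0" "z 1 = z 0"
      using nn that by (simp add: x_eq b_def)
    ultimately show ?thesis
      by blast
  qed
  \<comment> \<open>The opposite signs come from \<open>main\<close> applied to - x, whose data are
    - d and - z.\<close>
  have "- x t = - d + (- z t) - 2 * (- z (Suc t)) + (- z (Suc (Suc t)))" for t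
    by (simp add: x)
  note main[OF z x] main[OF bseqs_uminus[OF z] this]
  then show ?thesis
    using nonneg_lexicographic[of d x "z 0 - z 1"] by simp
qed

end

section \<open>Catching up\<close>

text \<open>A6 refers to a particular decision process, so it enters later as a comparability
  hypothesis on a single stream.\<close>

locale catching_up_preorder = translation_invariant_preorder +
  assumes A2: "axiom_A2 R"
    and A3: "axiom_A3 R"
    and A4: "axiom_A4 R"
    and A7: "axiom_A7 R"
begin

lemma nonneg_prepend:
  assumes "x \<in> bseqs"
  shows "nonneg (prepend 0 x) \<longleftrightarrow> nonneg x"
proof -
  have "prepend 0 (\<lambda>_. 0) = (\<lambda>_. 0)"
    by (auto simp: prepend_def fun_eq_iff split: nat.split)
  then show ?thesis
    using A4 assms bseqs_const[of 0] unfolding axiom_A4_def nonneg_def by metis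
qed

text \<open>Moving an entry \<open>c\<close> to another period of an otherwise zero stream
  interchanges \<open>c\<close> with 0.\<close>

lemma nonneg_interchange:
  "nonneg (\<lambda>t. c * unit_seq i t - c * unit_seq j t)"
proof (cases "i = j")
  case True
  then show ?thesis
    by (simp add: nonneg_of_pointwise bseqs_const)
next
  case False
  let ?v = "\<lambda>t. c * unit_seq i t" and ?u = "\<lambda>t. c * unit_seq j t"
  have "?u = ?v(i := ?v j, j := ?v i)"
    using False by (auto simp: unit_seq_def)
  then have "indifferent R ?u ?v"
    using A2 bseqs_unit_seq False unfolding axiom_A2_def by blast
  then show ?thesis
    by (simp add: indifferent_def in_R_iff bseqs_unit_seq)
qed

text \<open>Interchanges move the entries one by one into the first period, where they add up; a
  truncation is thus indifferent to its sum received at once.\<close>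

lemma nonneg_truncate:
  "nonneg (\<lambda>t. truncate n y t - sigma n y * unit_seq 0 t)"
  "nonneg (\<lambda>t. sigma n y * unit_seq 0 t - truncate n y t)"
proof (induction n)
  case 0
  {
    case 1
    show ?case by (simp add: truncate_def sigma_def nonneg_of_pointwise bseqs_const)
  next
    case 2
    show ?case by (simp add: truncate_def sigma_def nonneg_of_pointwise bseqs_const)
  }
next
  case (Suc n)
  have tr: "truncate (Suc n) y t = truncate n y t + y n * unit_seq n t" for t
    by (auto simp: truncate_def unit_seq_def less_Suc_eq)
  have sg: "sigma (Suc n) y = sigma n y + y n"
    by (simp add: sigma_def)
  {
    case 1
    show ?case
      using nonneg_add[OF Suc(1) nonneg_interchange[of "y n" n 0]] by (simp add: tr sg algebra_simps)
  next
    case 2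
    show ?case
      using nonneg_add[OF Suc(2) nonneg_interchange[of "y n" 0 n]] by (simp add: tr sg algebra_simps)
  }
qed

lemma truncate_pos:
  assumes "0 < sigma n y"
  shows "pos (truncate n y)"
proof -
  have "pos (\<lambda>t. sigma n y * unit_seq 0 t)"
    by (rule pos_of_pointwise[OF bseqs_unit_seq, where k = 0]) (use assms in \<open>auto simp: unit_seq_def\<close>)
  from pos_nonneg_add[OF this nonneg_truncate(1)[of n y]] show ?thesis
    by simp
qed

lemma bseqs_truncate: "truncate n y \<in> bseqs"
  by (rule bseqs_eventually_0[of n]) (simp add: truncate_def)

text \<open>A3 against the zero stream, as positive partial sums make the truncations strictly
  preferred to 0.\<close>

lemma nonneg_if_eventually_pos:
  assumes y: "y \<in> bseqs" and ev: "eventually (\<lambda>n. 0 < sigma n y) sequentially"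
  shows "nonneg y"
proof -
  obtain N where N: "\<And>n. n \<ge> N \<Longrightarrow> 0 < sigma n y"
    using ev unfolding eventually_sequentially by blast
  have 0: "truncate n (\<lambda>_. 0) = (\<lambda>_. 0)" for n
    by (simp add: truncate_def)
  \<comment> \<open>The maximum with 2 meets the requirement N > 1 of A3.\<close>
  have "strictly_pref R (truncate n y) (truncate n (\<lambda>_. 0))" if "n \<ge> max 2 N" for n
    using truncate_pos[OF N] that in_R_iff[OF bseqs_truncate bseqs_const, of n y 0]
      in_R_iff[OF bseqs_const bseqs_truncate, of 0 n y]
    by (simp add: strictly_pref_def 0 pos_def)
  then have "\<exists>N>1. \<forall>n\<ge>N. strictly_pref R (truncate n y) (truncate n (\<lambda>_. 0))"
    by (intro exI[of _ "max 2 N"]) auto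
  then show ?thesis
    using A3[unfolded axiom_A3_def, THEN bspec, OF y, THEN bspec, OF bseqs_const[of 0]]
    by (simp only: nonneg_def)
qed

text \<open>A7 closes the set of streams ranked below 0, which consists of the negatives of
  nonnegative streams; perturbing the first entry of \<open>x\<close> by e / 2 moves - x by at most
  e / 2.\<close>

lemma nonneg_limit:
  assumes x: "x \<in> bseqs" and le: "\<And>e. 0 < e \<Longrightarrow> nonneg (\<lambda>t. x t + e * unit_seq 0 t)"
  shows "nonneg x"
proof (rule ccontr)
  interpret M: Metric_space bseqs l1_dist
    by (rule Metric_space_bseqs)
  let ?C = "{v \<in> bseqs. (\<lambda>_. 0, v) \<in> R}"
  have mem: "(\<lambda>_. 0, \<lambda>t. - v t) \<in> R \<longleftrightarrow> nonneg v" if "v \<in> bseqs" for v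
    using in_R_iff[OF bseqs_const bseqs_uminus[OF that]] by simp
  assume "\<not> nonneg x"
  then have "(\<lambda>t. - x t) \<in> bseqs - ?C"
    using mem x by (simp add: bseqs_uminus)
  moreover have "closedin M.mtopology ?C"
    using A7 bseqs_const unfolding axiom_A7_def by blast
  ultimately obtain e where e: "e > 0" "disjnt ?C (M.mball (\<lambda>t. - x t) e)"
    unfolding M.closedin_metric by blast
  define v where "v t = x t + e / 2 * unit_seq 0 t" for t
  have v: "v \<in> bseqs" "nonneg v"
    unfolding v_def using e(1) le[of "e / 2"] nonneg_bseqs by auto
  have "(\<lambda>i. ennreal \<bar>- x i - - v i\<bar>) = (\<lambda>i. if i = 0 then ennreal (e / 2) else 0)"
    using e(1) by (auto simp: v_def unit_seq_def)
  then have "(\<Sum>i. ennreal \<bar>- x i - - v i\<bar>) = ennreal (e / 2)"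
    using sums_unique[OF sums_single[of 0 "\<lambda>_. ennreal (e / 2)"]] by simp
  then have "ennreal (l1_dist (\<lambda>t. - x t) (\<lambda>t. - v t)) \<le> ennreal (e / 2)"
    unfolding ennreal_l1_dist by simp
  then have "l1_dist (\<lambda>t. - x t) (\<lambda>t. - v t) < e"
    using e(1) by (subst (asm) ennreal_le_iff) auto
  then have "(\<lambda>t. - v t) \<in> M.mball (\<lambda>t. - x t) e"
    using v(1) x by (simp add: bseqs_uminus)
  moreover have "(\<lambda>t. - v t) \<in> ?C"
    using mem v by (simp add: bseqs_uminus)
  ultimately show False
    using e(2) by (auto simp: disjnt_def)
qed

lemma sigma_add_unit_seq:
  assumes "0 < n"
  shows "sigma n (\<lambda>t. x t + e * unit_seq 0 t) = sigma n x + e"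
  using assms
  by (simp add: sigma_def sum.distrib sum_distrib_left[symmetric] unit_seq_def of_bool_def sum.delta)

text \<open>Taking \<open>e\<close> from the first entry keeps the partial sums eventually positive;
  giving it back is a strict improvement by A1.\<close>

lemma pos_if_eventually_gt:
  assumes y: "y \<in> bseqs" and e: "0 < e" and ev: "eventually (\<lambda>n. e < sigma n y) sequentially"
  shows "pos y"
proof -
  have "eventually (\<lambda>n. 0 < sigma n (\<lambda>t. y t + (- e) * unit_seq 0 t)) sequentially"
    using ev eventually_gt_at_top[of 0]
    by eventually_elim (subst sigma_add_unit_seq; simp)
  then have nn: "nonneg (\<lambda>t. y t + (- e) * unit_seq 0 t)"
    by (intro nonneg_if_eventually_pos bseqs_add y bseqs_unit_seq)
  have "pos (\<lambda>t. e * unit_seq 0 t)"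
    by (rule pos_of_pointwise[OF bseqs_unit_seq, where k = 0]) (use e in \<open>auto simp: unit_seq_def\<close>)
  from pos_nonneg_add[OF this nn] show ?thesis
    by simp
qed

section \<open>Sums of successive shifts and their partial sums\<close>

text \<open>With S the shift that inserts a 0 in front, this is (I + S + ... + S^(k-1)) x in Horner
  form.\<close>

primrec shift_sum :: "nat \<Rightarrow> (nat \<Rightarrow> real) \<Rightarrow> nat \<Rightarrow> real" where
  "shift_sum 0 x = (\<lambda>_. 0)"
| "shift_sum (Suc k) x = (\<lambda>t. x t + prepend 0 (shift_sum k x) t)"

lemma bseqs_shift_sum: "x \<in> bseqs \<Longrightarrow> shift_sum k x \<in> bseqs"
  by (induction k) (simp_all add: bseqs_const bseqs_add bseqs_prepend)

lemma shift_sum_uminus: "shift_sum k (\<lambda>t. - x t) = (\<lambda>t. - shift_sum k x t)"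
proof (induction k)
  case (Suc k)
  have "prepend 0 (\<lambda>t. - y t) t = - prepend 0 y t" for y t
    by (cases t) (simp_all add: prepend_def)
  then show ?case
    by (simp add: Suc.IH)
qed simp

lemma nonneg_shift_sum: "nonneg x \<Longrightarrow> nonneg (shift_sum k x)"
proof (induction k)
  case 0
  then show ?case by (simp add: nonneg_of_pointwise bseqs_const)
next
  case (Suc k)
  then show ?case
    using nonneg_prepend[OF bseqs_shift_sum[OF nonneg_bseqs], of x k] by (simp add: nonneg_add)
qed

lemma sigma_prepend: "sigma (Suc n) (prepend 0 y) = sigma n y"
  unfolding sigma_def sum.lessThan_Suc_shift by (simp add: prepend_def)

text \<open>Each shift delays partial sums by one period, so the left side adds the partial sums of
  \<open>x\<close> over n + 1, ..., n + k terms. Each is the bias plus a first difference of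
  \<open>z\<close>, and these telescope.\<close>

lemma sigma_shift_sum:
  assumes x: "\<And>t. x t = z t - 2 * z (Suc t) + z (Suc (Suc t))"
  shows "sigma (n + k) (shift_sum k x) = real k * (z 0 - z 1) + (z (Suc n + k) - z (Suc n))"
proof (induction k)
  case 0
  then show ?case by (simp add: sigma_def)
next
  case (Suc k)
  have sg: "sigma t x = (z 0 - z 1) - (z t - z (Suc t))" for t
    by (induction t) (simp_all add: sigma_def x)
  have "sigma (n + Suc k) (shift_sum (Suc k) x) =
      sigma (Suc (n + k)) x + sigma (Suc (n + k)) (prepend 0 (shift_sum k x))"
    by (simp add: sigma_def sum.distrib)
  also have "\<dots> = sigma (Suc (n + k)) x + sigma (n + k) (shift_sum k x)"
    unfolding sigma_prepend ..
  finally show ?case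
    unfolding Suc.IH sg by (simp add: algebra_simps)
qed

lemma nonneg_iff_second_difference:
  assumes z: "z \<in> bseqs" "recurrent z"
    and x: "\<And>t. x t = d + z t - 2 * z (Suc t) + z (Suc (Suc t))"
    and comp: "nonneg x \<or> nonneg (\<lambda>t. - x t)"
  shows "nonneg x \<longleftrightarrow> d > 0 \<or> d = 0 \<and> z 1 \<le> z 0"
proof -
  have bseq: "x \<in> bseqs" if z: "z \<in> bseqs"
    and x: "\<And>t. x t = d + z t - 2 * z (Suc t) + z (Suc (Suc t))" for x d z
  proof -
    have "(\<lambda>t. z (Suc t)) \<in> bseqs" "(\<lambda>t. z (Suc (Suc t))) \<in> bseqs"
      using z unfolding bseqs_iff by blast+
    then have "(\<lambda>t. d + z t - z (Suc t) - z (Suc t) + z (Suc (Suc t))) \<in> bseqs"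
      using z by (intro bseqs_intros)
    then show ?thesis
      by (simp add: x[abs_def])
  qed
  have gain: "pos x"
    if z: "z \<in> bseqs" and x: "\<And>t. x t = d + z t - 2 * z (Suc t) + z (Suc (Suc t))"
      and d: "0 < d" for x d z
  proof -
    obtain C where C: "\<And>t. \<bar>z t\<bar> \<le> C"
      using z bseqs_iff by blast
    have sg: "sigma t x = real t * d + (z 0 - z 1) - (z t - z (Suc t))" for t
      by (induction t) (simp_all add: sigma_def x algebra_simps)
    \<comment> \<open>Four values of \<open>z\<close> occur in \<open>sg\<close>, and
      \<open>4 * C\<close> bounds their total.\<close>
    obtain N :: nat where N: "4 * C + 1 < real N * d"
      using ex_less_of_nat_mult[OF d] by blast
    have "1 < sigma n x" if "n \<ge> N" for n
      using N mult_right_mono[of "real N" "real n" d] that d C[of 0] C[of 1] C[of n] C[of "Suc n"]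
      unfolding sg by (smt (verit) of_nat_le_iff)
    then show ?thesis
      using bseq[OF z x] by (intro pos_if_eventually_gt[of _ 1]) (auto intro: eventually_sequentiallyI)
  qed
  have bias: "pos x"
    if z: "z \<in> bseqs" and x: "\<And>t. x t = z t - 2 * z (Suc t) + z (Suc (Suc t))"
      and comp: "nonneg x \<or> nonneg (\<lambda>t. - x t)" and b: "z 1 < z 0" for x z
  proof -
    obtain C where C: "\<And>t. \<bar>z t\<bar> \<le> C"
      using z bseqs_iff by blast
    have xb: "x \<in> bseqs"
      using bseq[OF z, of x 0] x by simp
    \<comment> \<open>The boundary term left by telescoping is at most \<open>2 * C\<close>,
      whatever \<open>k\<close> is.\<close>
    obtain k :: nat where k: "2 * C + 1 < real k * (z 0 - z 1)"
      using ex_less_of_nat_mult[of "z 0 - z 1"] b by auto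
    have "1 < sigma n (shift_sum k x)" if "n \<ge> k" for n
      using sigma_shift_sum[of x z "n - k" k] x that k C[of "Suc n"] C[of "Suc n - k"]
      by (simp add: Suc_diff_le)
    then have "pos (shift_sum k x)"
      by (intro pos_if_eventually_gt[of _ 1] bseqs_shift_sum xb) (auto intro: eventually_sequentiallyI)
    \<comment> \<open>Were - x nonnegative, its shift sum would be too, yet that is the negative of
      a strictly positive stream. Comparability then yields \<open>nonneg x\<close>.\<close>
    then have "\<not> nonneg (\<lambda>t. - x t)"
      using nonneg_shift_sum[of "\<lambda>t. - x t" k] by (auto simp: pos_def shift_sum_uminus)
    then show ?thesis
      using comp by (simp add: pos_def)
  qed
  \<comment> \<open>Comparability leaves the case that - x is nonnegative; the other closes by
    assumption.\<close>
  have tie: "nonneg x" if d: "d = 0" and b: "z 1 = z 0"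
  proof (rule disjE[OF comp])
    assume neg: "nonneg (\<lambda>t. - x t)"
    have xb: "x \<in> bseqs"
      by (rule bseq[OF z(1) x])
    show ?thesis
    proof (rule nonneg_limit[OF xb])
      fix e :: real
      assume "0 < e"
      then obtain k n0 where k: "k > 0" and n0: "\<And>n. n \<ge> n0 \<Longrightarrow> \<bar>z (n + k) - z n\<bar> < e"
        using z(2) unfolding recurrent_def by meson
      obtain k' where k': "k = Suc k'"
        using k gr0_implies_Suc by blast
      \<comment> \<open>With zero bias the partial sum is a difference of \<open>z\<close> at
        distance \<open>k\<close>, smaller than \<open>e\<close> in absolute value by recurrence;
        the extra \<open>e\<close> makes it positive.\<close>
      have "0 < sigma n (\<lambda>t. shift_sum k x t + e * unit_seq 0 t)" if "n \<ge> n0 + k" for n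
      proof -
        have "Suc (n - k) \<ge> n0"
          using that by simp
        then show ?thesis
          using sigma_shift_sum[of x z "n - k" k] x d b n0[of "Suc (n - k)"] that k
          by (simp add: sigma_add_unit_seq)
      qed
      then have "nonneg (\<lambda>t. shift_sum k x t + e * unit_seq 0 t)"
        by (intro nonneg_if_eventually_pos bseqs_intros bseqs_shift_sum xb)
          (auto intro: eventually_sequentiallyI)
      \<comment> \<open>Adding this stream cancels all but the unshifted summand of
        \<open>shift_sum k x\<close>, leaving \<open>x\<close> with \<open>e\<close> added to its
        first entry.\<close>
      moreover have "nonneg (prepend 0 (\<lambda>t. - shift_sum k' x t))"
        using nonneg_shift_sum[OF neg, of k'] bseqs_shift_sum[OF xb, of k']
        by (simp add: nonneg_prepend bseqs_uminus shift_sum_uminus)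
      ultimately have "nonneg (\<lambda>t. (shift_sum k x t + e * unit_seq 0 t) + prepend 0 (\<lambda>t. - shift_sum k' x t) t)"
        by (rule nonneg_add)
      moreover have "(shift_sum k x t + e * unit_seq 0 t) + prepend 0 (\<lambda>t. - shift_sum k' x t) t =
          x t + e * unit_seq 0 t" for t
        by (auto simp: k' prepend_def split: nat.split)
      ultimately show "nonneg (\<lambda>t. x t + e * unit_seq 0 t)"
        by simp
    qed
  qed
  have neg: "- x t = - d + (- z t) - 2 * (- z (Suc t)) + (- z (Suc (Suc t)))" for t
    by (simp add: x)
  have "nonneg x \<longleftrightarrow> d > 0 \<or> d = 0 \<and> 0 \<le> z 0 - z 1"
  proof (rule nonneg_lexicographic)
    show "pos x" if "0 < d"
      by (rule gain[OF z(1) x that])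
    show "pos (\<lambda>t. - x t)" if "d < 0"
      by (rule gain[OF bseqs_uminus[OF z(1)] neg]) (use that in simp)
    show "pos x" if "d = 0" "0 < z 0 - z 1"
      by (rule bias[OF z(1) _ comp]) (use x that in simp_all)
    show "pos (\<lambda>t. - x t)" if "d = 0" "z 0 - z 1 < 0"
    proof (rule bias[OF bseqs_uminus[OF z(1)]])
      show "- x t = - z t - 2 * (- z (Suc t)) + (- z (Suc (Suc t)))" for t
        using neg[of t] that by simp
      show "nonneg (\<lambda>t. - x t) \<or> nonneg (\<lambda>t. - (- x t))"
        unfolding minus_minus using comp by blast
      show "- z 1 < - z 0"
        using that by simp
    qed
    show "nonneg x" if "d = 0" "z 0 - z 1 = 0"
      using that by (intro tie) simp_all
  qed
  then show ?thesis
    by simp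
qed

end

section \<open>Optimality\<close>

text \<open>Both relations reduce to the same lexicographic condition on \<open>d\<close> and
  \<open>z\<close>; under the first axiom set A6 supplies comparability.\<close>

lemma stationary_preference_iff:
  assumes p: "transition_probs p" and pre: "preorder_on bseqs R"
    and ax: "(axiom_A1 R \<and> axiom_A2 R \<and> axiom_A3 R \<and> axiom_A4 R \<and> axiom_A5 R
            \<and> axiom_A6 p r R \<and> axiom_A7 R)
         \<or> (axiom_A1 R \<and> axiom_A5 R \<and> axiom_A8 R)"
  shows "(reward_stream p r s (\<lambda>_. f), reward_stream p r s (\<lambda>_. f')) \<in> R \<longleftrightarrow>
    (reward_stream p r s (\<lambda>_. f), reward_stream p r s (\<lambda>_. f')) \<in> avg_overtaking"
proof -
  let ?u = "reward_stream p r s (\<lambda>_. f)" and ?v = "reward_stream p r s (\<lambda>_. f')"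
  let ?x = "\<lambda>t. ?u t - ?v t"
  obtain d z where z: "z \<in> bseqs" "recurrent z"
    and x: "\<And>t. ?x t = d + z t - 2 * z (Suc t) + z (Suc (Suc t))"
    using stationary_diff_form[OF p, of r s f f'] by blast
  note uv = stationary_streams_bseqs[OF p, of r s f] stationary_streams_bseqs[OF p, of r s f']
  interpret translation_invariant_preorder R
    using pre ax by unfold_locales auto
  have "nonneg ?x \<longleftrightarrow> d > 0 \<or> d = 0 \<and> z 1 \<le> z 0"
    using ax
  proof
    assume ax: "axiom_A1 R \<and> axiom_A2 R \<and> axiom_A3 R \<and> axiom_A4 R \<and> axiom_A5 R
            \<and> axiom_A6 p r R \<and> axiom_A7 R"
    then interpret catching_up_preorder R
      by unfold_locales auto
    have "?u \<in> stationary_streams p r" "?v \<in> stationary_streams p r"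
      unfolding stationary_streams_def stationary_policies_def by blast+
    then have "compares R ?u ?v"
      using ax unfolding axiom_A6_def by blast
    then have "nonneg ?x \<or> nonneg (\<lambda>t. - ?x t)"
      using in_R_iff[OF uv] in_R_iff[OF uv(2,1)] by (simp add: compares_def)
    then show ?thesis
      by (rule nonneg_iff_second_difference[OF z x])
  next
    assume "axiom_A1 R \<and> axiom_A5 R \<and> axiom_A8 R"
    then interpret compensation_preorder R
      by unfold_locales auto
    show ?thesis
      by (rule nonneg_iff_second_difference[OF z(1) x])
  qed
  then show ?thesis
    unfolding in_R_iff[OF uv] avg_overtaking_iff[OF uv z(1) x] .
qed

lemma stationary_policies_eq: "stationary_policies = range (\<lambda>f _. f)"
  by (auto simp: stationary_policies_def)

lemma optimal_policy_iff:
  "optimal_policy p r Q \<pi> \<longleftrightarrow> (\<exists>f. \<pi> = (\<lambda>_. f) \<and>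
    (\<forall>f' s. (reward_stream p r s (\<lambda>_. f), reward_stream p r s (\<lambda>_. f')) \<in> Q))"
  by (auto simp: optimal_policy_def stationary_policies_eq)

text \<open>A policy that is discounted optimal for \<beta> arbitrarily near 1 has frequently
  nonnegative discounted differences against every rival, in every state; this forces the
  lexicographic condition.\<close>

lemma avg_overtaking_optimal_exists:
  assumes p: "transition_probs p"
  shows "\<exists>\<pi>. optimal_policy p r avg_overtaking \<pi>"
proof -
  obtain f where f: "frequently
      (\<lambda>\<beta>. \<forall>f' s. discounted_value p r \<beta> f' s \<le> discounted_value p r \<beta> f s) (at_left 1)"
    by (rule frequently_discounted_optimal[OF p, where r = r])
  have "(reward_stream p r s (\<lambda>_. f), reward_stream p r s (\<lambda>_. f')) \<in> avg_overtaking" for s f'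
  proof -
    let ?u = "reward_stream p r s (\<lambda>_. f)" and ?v = "reward_stream p r s (\<lambda>_. f')"
    obtain d z where z: "z \<in> bseqs"
      and x: "\<And>t. ?u t - ?v t = d + z t - 2 * z (Suc t) + z (Suc (Suc t))"
      using stationary_diff_form[OF p, of r s f f'] by blast
    note uv = stationary_streams_bseqs[OF p, of r s f] stationary_streams_bseqs[OF p, of r s f']
    have diff: "(\<Sum>t. \<beta> ^ t * (?u t - ?v t)) = discounted_value p r \<beta> f s - discounted_value p r \<beta> f' s"
      if "0 < \<beta>" "\<beta> < 1" for \<beta>
      using suminf_diff[OF bseqs_summable[OF uv(1) that] bseqs_summable[OF uv(2) that]]
      by (simp add: discounted_value_def right_diff_distrib)
    have "eventually (\<lambda>\<beta>. 0 < \<beta> \<and> \<beta> < 1) (at_left (1::real))"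
      by (auto simp: eventually_at_left[of 0 "1::real"] intro!: exI[of _ 0])
    from frequently_eventually_conj[OF f this]
    have "frequently (\<lambda>\<beta>. 0 \<le> (\<Sum>t. \<beta> ^ t * (?u t - ?v t))) (at_left 1)"
      by (rule frequently_elim1) (simp add: diff)
    from discounted_sum_frequently_nonneg[OF z x this] show ?thesis
      by (simp add: avg_overtaking_iff[OF uv z x])
  qed
  then have "optimal_policy p r avg_overtaking (\<lambda>_. f)"
    unfolding optimal_policy_iff by blast
  then show ?thesis
    by blast
qed

theorem mainTheorem4:
  fixes p :: "'a::finite \<Rightarrow> 's::finite \<Rightarrow> 's \<Rightarrow> real"
    and r :: "'s \<Rightarrow> 'a \<Rightarrow> real"
    and R :: "(nat \<Rightarrow> real) rel"
  assumes "transition_probs p"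
    and "preorder_on bseqs R"
    and "(axiom_A1 R \<and> axiom_A2 R \<and> axiom_A3 R \<and> axiom_A4 R \<and> axiom_A5 R
            \<and> axiom_A6 p r R \<and> axiom_A7 R)
         \<or> (axiom_A1 R \<and> axiom_A5 R \<and> axiom_A8 R)"
  shows "(\<forall>\<pi>. optimal_policy p r R \<pi> \<longleftrightarrow> optimal_policy p r avg_overtaking \<pi>)
         \<and> (\<exists>\<pi>. optimal_policy p r R \<pi>)"
proof -
  \<comment> \<open>Optimality compares only stationary streams from a common initial state, where
    the two relations agree.\<close>
  have "optimal_policy p r R \<pi> \<longleftrightarrow> optimal_policy p r avg_overtaking \<pi>" for \<pi>
    unfolding optimal_policy_iff stationary_preference_iff[OF assms] ..
  then show ?thesis
    using avg_overtaking_optimal_exists[OF assms(1)] by blast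
qed

end
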